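(* Let $w_1,\dots,w_p$ be nonempty reduced words in $F_2=\langle a,b\rangle$ and let $W_1,\dots,W_p$ be the corresponding functions on $\mathcal{U}(N)^2$ obtained by substituting $(U,V)$ for $(a,b)$. Let $X=\tilde U\cup\tilde U^*\cup\tilde V\cup\tilde V^*$ be the set of letter occurrences in $|\operatorname{Tr}(W_1)|^2\cdots|\operatorname{Tr}(W_p)|^2$, with $n=|\tilde U|=|\tilde U^*|$ and $m=|\tilde V|=|\tilde V^*|$, let $\Psi,I:X\to X$ be the maps defined in the context, and assume $N>\max(n,m)$. Let $$R=\sum_{\substack{\sigma_u\in S_{\tilde U},\ \theta_u\in S_{\tilde U^*}\\ \sigma_v\in S_{\tilde V},\ \theta_v\in S_{\tilde V^*}}}N^{\sharp(I\circ(\sigma_u,\theta_u,\sigma_v,\theta_v))}\;\sigma_u\otimes\theta_u\otimes\sigma_v\otimes\theta_v\ \in\ \mathbb{C}(S_{\tilde U})\otimes\mathbb{C}(S_{\tilde U^*})\otimes\mathbb{C}(S_{\tilde V})\otimes\mathbb{C}(S_{\tilde V^*}).$$ Up to relabelling the elements of the four sets $\tilde U,\tilde U^*,\tilde V,\tilde V^*$ (by bijections), for given $N$ and given cardinalities $n,m$, the element $R$ depends only on the cardinalities of the sets $I(A)\cap B$, where $A,B$ range over distinct members of $\{\tilde U,\tilde U^*,\tilde V,\tilde V^*\}$. Let $\Phi$ be the linear map from $\mathbb{C}(S_{\tilde U})\otimes\mathbb{C}(S_{\tilde U^*})\otimes\mathbb{C}(S_{\tilde V})\otimes\mathbb{C}(S_{\tilde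 V^*})$ into $\mathbb{C}$ determined by $$\Phi(\sigma_1\otimes\theta_1\otimes\sigma_2\otimes\theta_2)=W^N_{\sigma_1\Psi^{-1}\theta_1\Psi}\;W^N_{\sigma_2\Psi^{-1}\theta_2\Psi}.$$ Then $$\iint_{\mathcal{U}(N)^2}|\operatorname{Tr}(W_1)|^2\cdots|\operatorname{Tr}(W_p)|^2\,dU\,dV=\Phi(R).$$
   Context: $\mathcal{U}(N)$ is the group of $N\times N$ unitary matrices, $dU,dV$ the normalized Haar measure, $\operatorname{Tr}$ the non-normalized trace. Weingarten coefficients: for a finite set $E$ with $|E|=k<N$, let $S_E$ be its group of permutations and $\sharp\sigma$ the number of cycles (fixed points included) of $\sigma\in S_E$. The element $\sum_{\sigma\in S_E}N^{\sharp\sigma}\sigma$ of the group algebra $\mathbb{C}[S_E]$ is central and invertible; $W^N_\sigma$ denotes the coefficient of $\sigma$ in its inverse. (If $E=\emptyset$ the coefficient is $1$.) Letter set: write $|\operatorname{Tr}(W_1)|^2\cdots|\operatorname{Tr}(W_p)|^2=\prod_{i}\operatorname{Tr}(W_i)\operatorname{Tr}(W_i^{-1})$, where $w_i^{-1}$ is the inverse word of $w_i$ (letters inverted, order reversed). $X$ is the set of all letter occurrences in the $2p$ words $w_1,w_1^{-1},\dots,w_p,w_p^{-1}$ (one element per occurrence), and $\tilde U,\tilde U^*,\tilde V,\tilde V^*\subset X$ are the subsets of occurrences of the symbols $U,U^*=U^{-1},V,V^*=V^{-1}$ respectively (corresponding to $a,a^{-1},b,b^{-1}$). Thus $|X|=2(n+m)$.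 The map $\Psi:X\to X$ sends an occurrence of a letter in $w_i$ to the corresponding occurrence of the inverse letter in $w_i^{-1}$ (the letter in position $k$ of $w_i$, of length $\ell$, corresponds to the letter in position $\ell+1-k$ of $w_i^{-1}$), and vice versa. It is an involution exchanging $\tilde U$ with $\tilde U^*$ and $\tilde V$ with $\tilde V^*$. The map $I:X\to X$ sends an occurrence $x$ to the cyclic successor of $\Psi(x)$ in the word that contains $\Psi(x)$ (the successor of the last letter of a word being its first letter). For $\sigma_u\in S_{\tilde U}$, $\theta_u\in S_{\tilde U^*}$, $\sigma_v\in S_{\tilde V}$, $\theta_v\in S_{\tilde V^*}$, $(\sigma_u,\theta_u,\sigma_v,\theta_v)$ denotes the permutation of $X$ that restricts to these four permutations on the four subsets, and $\sharp(I\circ(\sigma_u,\theta_u,\sigma_v,\theta_v))$ is the number of cycles of the composed permutation of $X$. In $\sigma_1\Psi^{-1}\theta_1\Psi$ and $\sigma_2\Psi^{-1}\theta_2\Psi$ the map $\Psi$ is restricted to $\tilde U\to\tilde U^*$, respectively $\tilde V\to\tilde V^*$, so these are permutations of $\tilde U$, respectively $\tilde V$. *)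

theory Defs
  imports "HOL-Analysis.Analysis" "HOL-Combinatorics.Orbits"
begin

section \<open>The unitary group and its Haar measure\<close>

definition conj_transpose :: "complex ^ 'n ^ 'n \<Rightarrow> complex ^ 'n ^ 'n" where
  "conj_transpose A = (\<chi> i j. cnj (A $ j $ i))"

definition unitary_group :: "(complex ^ 'n ^ 'n) set" where
  "unitary_group = {U. conj_transpose U ** U = mat 1 \<and> U ** conj_transpose U = mat 1}"

text \<open>
  The library has no Haar measure. \<open>haar_measure \<mu>\<close> says that \<open>\<mu>\<close> is a left-invariant Borel
  probability measure on \<open>U(N)\<close>. As \<open>U(N)\<close> is a compact metrizable group there is exactly one
  such measure, and it is automatically regular, right-invariant and inversion-invariant.
\<close>

definition haar_measure :: "(complex ^ 'n ^ 'n) measure \<Rightarrow> bool" where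
  "haar_measure \<mu> \<longleftrightarrow>
     sets \<mu> = sets (restrict_space borel unitary_group) \<and>
     emeasure \<mu> (space \<mu>) = 1 \<and>
     (\<forall>g \<in> unitary_group. \<forall>A \<in> sets \<mu>. emeasure \<mu> ((\<lambda>h. g ** h) ` A) = emeasure \<mu> A)"


section \<open>Words in two generators\<close>

text \<open>The letters $a$, $a^{-1}$, $b$, $b^{-1}$.\<close>

datatype letter = GenA | InvA | GenB | InvB

fun inv_letter :: "letter \<Rightarrow> letter" where
  "inv_letter GenA = InvA"
| "inv_letter InvA = GenA"
| "inv_letter GenB = InvB"
| "inv_letter InvB = GenB"

definition inv_word :: "letter list \<Rightarrow> letter list" where
  "inv_word w = rev (map inv_letter w)"

text \<open>Elements of the free group of rank two are represented by reduced words.\<close>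

definition reduced :: "letter list \<Rightarrow> bool" where
  "reduced w \<longleftrightarrow> (\<forall>k. Suc k < length w \<longrightarrow> w ! Suc k \<noteq> inv_letter (w ! k))"

fun letter_matrix :: "complex ^ 'n ^ 'n \<Rightarrow> complex ^ 'n ^ 'n \<Rightarrow> letter \<Rightarrow> complex ^ 'n ^ 'n" where
  "letter_matrix U V GenA = U"
| "letter_matrix U V InvA = conj_transpose U"
| "letter_matrix U V GenB = V"
| "letter_matrix U V InvB = conj_transpose V"

definition word_matrix ::
    "complex ^ 'n ^ 'n \<Rightarrow> complex ^ 'n ^ 'n \<Rightarrow> letter list \<Rightarrow> complex ^ 'n ^ 'n" where
  "word_matrix U V w = foldr (\<lambda>l M. letter_matrix U V l ** M) w (mat 1)"


section \<open>Letter occurrences\<close>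

text \<open>
  \<open>(i, s, k)\<close> is the letter in position \<open>k\<close> (counted from \<open>0\<close>) of the word \<open>ws ! i\<close> if
  \<open>s = False\<close>, and of its inverse word if \<open>s = True\<close>.
\<close>

type_synonym occ = "nat \<times> bool \<times> nat"

definition occs :: "letter list list \<Rightarrow> occ set" where
  "occs ws = {(i, s, k). i < length ws \<and> k < length (ws ! i)}"

fun letter_at :: "letter list list \<Rightarrow> occ \<Rightarrow> letter" where
  "letter_at ws (i, s, k) = (if s then inv_word (ws ! i) else ws ! i) ! k"

text \<open>The sets \<open>U\<close>, \<open>U\<^sup>*\<close>, \<open>V\<close>, \<open>V\<^sup>*\<close> of occurrences are \<open>occs_of ws c\<close> for
  \<open>c = GenA, InvA, GenB, InvB\<close>.\<close>

definition occs_of :: "letter list list \<Rightarrow> letter \<Rightarrow> occ set" where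
  "occs_of ws c = {x \<in> occs ws. letter_at ws x = c}"

fun next_occ :: "letter list list \<Rightarrow> occ \<Rightarrow> occ" where
  "next_occ ws (i, s, k) = (i, s, Suc k mod length (ws ! i))"

text \<open>Maps and permutations of \<open>X\<close> are extended by the identity outside \<open>X\<close>.\<close>

fun Psi :: "letter list list \<Rightarrow> occ \<Rightarrow> occ" where
  "Psi ws (i, s, k) =
     (if (i, s, k) \<in> occs ws then (i, \<not> s, length (ws ! i) - 1 - k) else (i, s, k))"

definition I_map :: "letter list list \<Rightarrow> occ \<Rightarrow> occ" where
  "I_map ws x = (if x \<in> occs ws then next_occ ws (Psi ws x) else x)"


section \<open>Group algebras of symmetric groups and Weingarten coefficients\<close>

definition num_cycles :: "'a set \<Rightarrow> ('a \<Rightarrow> 'a) \<Rightarrow> nat" where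
  "num_cycles E \<sigma> = card (orbit \<sigma> ` E)"

text \<open>
  An element of the group algebra of the symmetric group of \<open>E\<close> is represented by its coefficient
  function, which vanishes outside \<open>{\<sigma>. \<sigma> permutes E}\<close>.
\<close>

definition group_algebra :: "'a set \<Rightarrow> (('a \<Rightarrow> 'a) \<Rightarrow> complex) set" where
  "group_algebra E = {f. \<forall>\<sigma>. \<not> \<sigma> permutes E \<longrightarrow> f \<sigma> = 0}"

definition ga_mult ::
    "'a set \<Rightarrow> (('a \<Rightarrow> 'a) \<Rightarrow> complex) \<Rightarrow> (('a \<Rightarrow> 'a) \<Rightarrow> complex) \<Rightarrow> ('a \<Rightarrow> 'a) \<Rightarrow> complex" where
  "ga_mult E f g \<sigma> =
     (\<Sum>(\<tau>, \<rho>) \<in> {(\<tau>, \<rho>). \<tau> permutes E \<and> \<rho> permutes E \<and> \<tau> \<circ> \<rho> = \<sigma>}. f \<tau> * g \<rho>)"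

definition ga_one :: "('a \<Rightarrow> 'a) \<Rightarrow> complex" where
  "ga_one \<sigma> = (if \<sigma> = id then 1 else 0)"

definition cycle_element :: "nat \<Rightarrow> 'a set \<Rightarrow> ('a \<Rightarrow> 'a) \<Rightarrow> complex" where
  "cycle_element N E \<sigma> = (if \<sigma> permutes E then of_nat N ^ num_cycles E \<sigma> else 0)"

definition weingarten :: "nat \<Rightarrow> 'a set \<Rightarrow> ('a \<Rightarrow> 'a) \<Rightarrow> complex" where
  "weingarten N E = (THE W. W \<in> group_algebra E \<and>
     ga_mult E (cycle_element N E) W = ga_one \<and> ga_mult E W (cycle_element N E) = ga_one)"


section \<open>The element \<open>R\<close> and the functional \<open>\<Phi>\<close>\<close>

type_synonym perm4 = "(occ \<Rightarrow> occ) \<times> (occ \<Rightarrow> occ) \<times> (occ \<Rightarrow> occ) \<times> (occ \<Rightarrow> occ)"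

definition perms4 :: "letter list list \<Rightarrow> perm4 set" where
  "perms4 ws = {\<sigma>. \<sigma> permutes occs_of ws GenA} \<times> {\<theta>. \<theta> permutes occs_of ws InvA} \<times>
               {\<sigma>. \<sigma> permutes occs_of ws GenB} \<times> {\<theta>. \<theta> permutes occs_of ws InvB}"

text \<open>
  An element of the tensor product of the four group algebras is represented by its coefficients
  in the basis of the elementary tensors of permutations; the coefficient function vanishes
  outside \<open>perms4 ws\<close>.
\<close>

definition tensor_space :: "letter list list \<Rightarrow> (perm4 \<Rightarrow> complex) set" where
  "tensor_space ws = {T. \<forall>q. q \<notin> perms4 ws \<longrightarrow> T q = 0}"

definition basis_tensor :: "perm4 \<Rightarrow> perm4 \<Rightarrow> complex" where
  "basis_tensor q = (\<lambda>r. if r = q then 1 else 0)"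

fun glue :: "letter list list \<Rightarrow> perm4 \<Rightarrow> occ \<Rightarrow> occ" where
  "glue ws (\<sigma>\<^sub>u, \<theta>\<^sub>u, \<sigma>\<^sub>v, \<theta>\<^sub>v) x =
     (if x \<in> occs ws then
        (case letter_at ws x of GenA \<Rightarrow> \<sigma>\<^sub>u x | InvA \<Rightarrow> \<theta>\<^sub>u x | GenB \<Rightarrow> \<sigma>\<^sub>v x | InvB \<Rightarrow> \<theta>\<^sub>v x)
      else x)"

definition R_element :: "nat \<Rightarrow> letter list list \<Rightarrow> perm4 \<Rightarrow> complex" where
  "R_element N ws q =
     (if q \<in> perms4 ws then of_nat N ^ num_cycles (occs ws) (I_map ws \<circ> glue ws q) else 0)"

text \<open>
  The composite \<open>\<sigma> \<circ> inv (Psi ws) \<circ> \<theta> \<circ> Psi ws\<close> below is taken on the whole type; for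
  \<open>\<sigma>\<close> permuting \<open>U\<close> and \<open>\<theta>\<close> permuting \<open>U\<^sup>*\<close> it permutes \<open>U\<close>, see
  \<open>twisted_permutes\<close>.
\<close>

fun Phi_basis :: "nat \<Rightarrow> letter list list \<Rightarrow> perm4 \<Rightarrow> complex" where
  "Phi_basis N ws (\<sigma>\<^sub>1, \<theta>\<^sub>1, \<sigma>\<^sub>2, \<theta>\<^sub>2) =
     weingarten N (occs_of ws GenA) (\<sigma>\<^sub>1 \<circ> inv (Psi ws) \<circ> \<theta>\<^sub>1 \<circ> Psi ws) *
     weingarten N (occs_of ws GenB) (\<sigma>\<^sub>2 \<circ> inv (Psi ws) \<circ> \<theta>\<^sub>2 \<circ> Psi ws)"

definition Phi :: "nat \<Rightarrow> letter list list \<Rightarrow> (perm4 \<Rightarrow> complex) \<Rightarrow> complex" where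
  "Phi N ws T = (\<Sum>q\<in>perms4 ws. T q * Phi_basis N ws q)"

text \<open>
  Relabelling along a map \<open>f\<close> that is bijective from each of the four occurrence sets of \<open>ws\<close>
  to the corresponding set for another word list.
\<close>

fun relabel4 :: "letter list list \<Rightarrow> (letter \<Rightarrow> occ \<Rightarrow> occ) \<Rightarrow> perm4 \<Rightarrow> perm4" where
  "relabel4 ws f (\<sigma>\<^sub>u, \<theta>\<^sub>u, \<sigma>\<^sub>v, \<theta>\<^sub>v) =
     (map_permutation (occs_of ws GenA) (f GenA) \<sigma>\<^sub>u,
      map_permutation (occs_of ws InvA) (f InvA) \<theta>\<^sub>u,
      map_permutation (occs_of ws GenB) (f GenB) \<sigma>\<^sub>v,
      map_permutation (occs_of ws InvB) (f InvB) \<theta>\<^sub>v)"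


section \<open>Basic facts about these notions\<close>

lemma inv_letter_invol [simp]: "inv_letter (inv_letter c) = c"
  by (cases c) auto

lemma finite_occs [simp]: "finite (occs ws)"
proof -
  have "occs ws \<subseteq> {..<length ws} \<times> UNIV \<times> (\<Union>i<length ws. {..<length (ws ! i)})"
    by (auto simp: occs_def)
  then show ?thesis
    by (rule finite_subset) auto
qed

lemma finite_occs_of [simp]: "finite (occs_of ws c)"
  by (simp add: occs_of_def)

lemma Psi_in_occs: "x \<in> occs ws \<Longrightarrow> Psi ws x \<in> occs ws"
  by (cases x) (auto simp: occs_def)

lemma Psi_Psi [simp]: "Psi ws (Psi ws x) = x"
  by (cases x) (auto simp: occs_def)

lemma inv_Psi: "inv (Psi ws) = Psi ws"
  by (rule inv_equality) auto

lemma letter_at_Psi: "x \<in> occs ws \<Longrightarrow> letter_at ws (Psi ws x) = inv_letter (letter_at ws x)"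
  by (cases x) (auto simp: occs_def inv_word_def rev_nth)

declare Psi.simps [simp del]

lemma Psi_occs_of: "x \<in> occs_of ws c \<Longrightarrow> Psi ws x \<in> occs_of ws (inv_letter c)"
  by (auto simp: occs_of_def Psi_in_occs letter_at_Psi)

lemma bij_betw_Psi: "bij_betw (Psi ws) (occs_of ws c) (occs_of ws (inv_letter c))"
proof (rule bij_betw_byWitness[where f' = "Psi ws"])
  show "Psi ws ` occs_of ws (inv_letter c) \<subseteq> occs_of ws c"
    using Psi_occs_of[of _ ws "inv_letter c"] by auto
qed (auto simp: Psi_occs_of)

lemma card_occs_of_inv: "card (occs_of ws (inv_letter c)) = card (occs_of ws c)"
  using bij_betw_same_card[OF bij_betw_Psi] by metis

lemma twisted_permutes:
  assumes "\<sigma> permutes occs_of ws c" "\<theta> permutes occs_of ws (inv_letter c)"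
  shows "(\<sigma> \<circ> inv (Psi ws) \<circ> \<theta> \<circ> Psi ws) permutes occs_of ws c"
proof -
  have b: "bij (Psi ws)" by (rule o_bij[where g = "Psi ws"]) (auto simp: fun_eq_iff)
  have "(inv (Psi ws) \<circ> \<theta> \<circ> Psi ws) permutes occs_of ws c"
    unfolding inv_Psi permutes_def
  proof (intro conjI allI impI)
    fix x assume "x \<notin> occs_of ws c"
    then have "Psi ws x \<notin> occs_of ws (inv_letter c)"
      using Psi_occs_of[of "Psi ws x" ws "inv_letter c"] by auto
    then show "(Psi ws \<circ> \<theta> \<circ> Psi ws) x = x"
      using assms(2) by (simp add: permutes_not_in)
  next
    fix y
    have "bij (Psi ws \<circ> \<theta> \<circ> Psi ws)"
      using b permutes_bij[OF assms(2)] by (intro bij_comp)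
    then show "\<exists>!x. (Psi ws \<circ> \<theta> \<circ> Psi ws) x = y"
      unfolding bij_iff by (rule spec)
  qed
  from permutes_compose[OF this assms(1)] show ?thesis
    by (simp only: o_assoc)
qed

lemma I_map_invol: "x \<in> occs ws \<Longrightarrow> I_map ws (I_map ws x) = x"
  and I_map_in_occs: "x \<in> occs ws \<Longrightarrow> I_map ws x \<in> occs ws"
proof -
  assume x: "x \<in> occs ws"
  obtain i s k where [simp]: "x = (i, s, k)" by (cases x)
  from x have ik: "i < length ws" "k < length (ws ! i)" by (auto simp: occs_def)
  define l where "l = length (ws ! i)"
  have k: "k < l" and l: "length (ws ! i) = l" using ik by (auto simp: l_def)
  have I: "I_map ws (i, t, j) = (i, \<not> t, (l - j) mod l)" if "j < l" for t j
    using that ik(1) by (auto simp: I_map_def Psi.simps occs_def l Suc_diff_Suc)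
  have m: "(l - k) mod l < l" using k by simp
  have "(l - (l - k) mod l) mod l = k" using k by (cases k) auto
  then show "I_map ws (I_map ws x) = x" using I k m by simp
  show "I_map ws x \<in> occs ws" using I[OF k] m ik(1) by (simp add: occs_def l)
qed

lemma I_map_permutes: "I_map ws permutes occs ws"
proof (rule bij_imp_permutes)
  show "bij_betw (I_map ws) (occs ws) (occs ws)"
    by (rule bij_betw_byWitness[where f' = "I_map ws"]) (auto simp: I_map_invol I_map_in_occs)
qed (simp add: I_map_def)

lemma finite_perms4 [simp]: "finite (perms4 ws)"
  unfolding perms4_def by (intro finite_cartesian_product finite_permutations finite_occs_of)

lemma R_element_in: "R_element N ws \<in> tensor_space ws"
  by (simp add: tensor_space_def R_element_def)

lemma R_element_expand:
  "R_element N ws r = (\<Sum>q\<in>perms4 ws.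
     of_nat N ^ num_cycles (occs ws) (I_map ws \<circ> glue ws q) * basis_tensor q r)"
  by (simp add: R_element_def basis_tensor_def if_distrib[where f = "\<lambda>c. _ * c"] cong: if_cong)

text \<open>\<open>Phi\<close> is the linear map with the prescribed values on elementary tensors.\<close>

lemma Phi_add: "Phi N ws (\<lambda>q. S q + T q) = Phi N ws S + Phi N ws T"
  by (simp only: Phi_def distrib_right sum.distrib)

lemma Phi_scale: "Phi N ws (\<lambda>q. c * T q) = c * Phi N ws T"
  by (simp only: Phi_def sum_distrib_left mult.assoc)

lemma Phi_basis_tensor: "q \<in> perms4 ws \<Longrightarrow> Phi N ws (basis_tensor q) = Phi_basis N ws q"
  by (simp add: Phi_def basis_tensor_def if_distrib[where f = "\<lambda>c. c * _"] cong: if_cong)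

lemma Phi_unique:
  assumes add: "\<And>S T. F (\<lambda>q. S q + T q) = F S + F T"
    and scale: "\<And>c T. F (\<lambda>q. c * T q) = c * F T"
    and basis: "\<And>q. q \<in> perms4 ws \<Longrightarrow> F (basis_tensor q) = Phi_basis N ws q"
    and T: "T \<in> tensor_space ws"
  shows "F T = Phi N ws T"
proof -
  have fin: "F (\<lambda>r. \<Sum>q\<in>A. T q * basis_tensor q r) = (\<Sum>q\<in>A. T q * Phi_basis N ws q)"
    if "finite A" "A \<subseteq> perms4 ws" for A
    using that
  proof (induction A rule: finite_induct)
    case empty
    then show ?case using scale[of 0] by simp
  next
    case (insert q A)
    have "F (\<lambda>r. T q * basis_tensor q r + (\<Sum>q\<in>A. T q * basis_tensor q r))
        = T q * F (basis_tensor q) + F (\<lambda>r. \<Sum>q\<in>A. T q * basis_tensor q r)"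
      by (simp only: add scale)
    with insert show ?case by (simp add: basis)
  qed
  have expand: "(\<lambda>r. \<Sum>q\<in>perms4 ws. T q * basis_tensor q r) = T"
  proof
    fix r
    show "(\<Sum>q\<in>perms4 ws. T q * basis_tensor q r) = T r"
      using T by (cases "r \<in> perms4 ws")
        (simp_all add: basis_tensor_def tensor_space_def if_distrib[where f = "\<lambda>c. _ * c"]
          del: split_paired_All cong: if_cong)
  qed
  show ?thesis
    using fin[OF finite_perms4 subset_refl] unfolding expand Phi_def .
qed

end

theory Submission
  imports Defs
begin

text \<open>
  The integral is computed by Weingarten calculus. Expanding every trace as a sum over matrix
  indices turns \<open>\<Prod>w. \<bar>Tr W\<bar>\<^sup>2\<close> into a sum over all colourings \<open>c\<close> of the letter occurrences by
  matrix indices, an occurrence \<open>x\<close> contributing the entry in row \<open>c x\<close> and column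
  \<open>c (next_occ ws x)\<close> of its letter (\<open>trace_product_expansion\<close>). The map \<open>\<Psi>\<close> pairs each entry of
  \<open>U\<close> with a complex conjugate entry of \<open>U\<close>, and likewise for \<open>V\<close>, so every colouring leads to one
  mixed moment of matrix entries for each of the two Haar unitaries.

  Such a moment is given by the Weingarten formula (\<open>weingarten_formula\<close>): it is a sum over pairs of
  permutations \<open>\<sigma>\<close>, \<open>\<tau>\<close> that match the row indices and the column indices, weighted by the coefficient
  of \<open>\<sigma> \<circ> \<tau>\<close>. Conjugating \<open>\<tau>\<close> by \<open>\<Psi>\<close> into a permutation \<open>\<theta>\<close> of the inverse occurrences makes both
  matching conditions say the same thing, namely that \<open>c\<close> is constant along the cycles of
  \<open>I \<circ> (\<sigma>\<^sub>u, \<theta>\<^sub>u, \<sigma>\<^sub>v, \<theta>\<^sub>v)\<close>. There are \<open>N\<close> to the number of these cycles such colourings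
  (\<open>card_tuples_fixed\<close>), which are the coefficients of \<open>R\<close>; this gives \<open>integral_eq_Phi_R\<close>.

  The Weingarten formula itself rests on two facts about an index set with at most \<open>N\<close> elements.
  First, averaging over a left invariant measure produces operators that commute with
  all tensor powers of unitary matrices, and such an operator is a combination of permutations of the
  tensor factors (\<open>commutant_of_unitary_power\<close>). Since there are at most as many tensor factors as
  basis vectors, this part of Schur-Weyl duality has a short proof: an operator in the commutant
  is determined by its value on one tensor product of distinct basis vectors, and comparing weights for
  diagonal unitary matrices shows that this value is spanned by the permuted tensors. Secondly, the coefficients
  of the combination are found by taking traces against permutations. This gives a linear
  system whose matrix is the Gram matrix \<open>N ^ \<sharp>(\<tau> \<circ> inv \<sigma>)\<close>; it is
  invertible because the permutation operators are linearly independent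
  (\<open>cycle_element_injective\<close>), and its inverse consists of the Weingarten coefficients.

  For the statement on relabelling, note that \<open>I\<close> is an involution without fixed points, since it
  exchanges the words with their inverses. Such an involution on a set that is split into
  labelled parts is determined up to isomorphism by the number of points of each part that are sent to
  each part (\<open>labelled_involutions_isomorphic\<close>), and a bijection that respects the
  labels and the involution carries cycles to cycles.
\<close>

section \<open>Counting index tuples fixed by a permutation\<close>

abbreviation tuples :: "'a set \<Rightarrow> ('a \<Rightarrow> 'n) set" where
  "tuples E \<equiv> E \<rightarrow>\<^sub>E UNIV"

lemma finite_tuples [simp]: "finite E \<Longrightarrow> finite (tuples E :: ('a \<Rightarrow> 'n :: finite) set)"
  by (rule finite_PiE) auto

lemma tuple_comp_permutes:
  assumes "i \<in> tuples E" "\<sigma> permutes E"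
  shows "i \<circ> \<sigma> \<in> tuples E"
proof
  fix x assume "x \<notin> E"
  then show "(i \<circ> \<sigma>) x = undefined"
    using assms by (auto simp: permutes_not_in)
qed auto

lemma tuple_comp_eq_iff:
  assumes "\<sigma> permutes E"
  shows "i \<circ> \<sigma> = i' \<longleftrightarrow> i = i' \<circ> inv \<sigma>"
proof
  assume "i \<circ> \<sigma> = i'"
  then have "i' \<circ> inv \<sigma> = i \<circ> (\<sigma> \<circ> inv \<sigma>)" by (simp add: o_assoc)
  then show "i = i' \<circ> inv \<sigma>" by (simp add: permutes_inv_o[OF assms])
next
  assume "i = i' \<circ> inv \<sigma>"
  then show "i \<circ> \<sigma> = i'" by (simp add: o_assoc[symmetric] permutes_inv_o[OF assms])
qed

lemma self_in_orbit_permutes: "finite E \<Longrightarrow> \<pi> permutes E \<Longrightarrow> x \<in> orbit \<pi> x"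
  by (rule permutation_self_in_orbit) (auto simp: permutation_permutes)

text \<open>
  An index tuple is fixed by \<open>\<pi>\<close> iff it is constant on the cycles of \<open>\<pi>\<close>, so it amounts to a free
  choice of one value for each cycle.
\<close>

lemma card_tuples_fixed:
  assumes E: "finite E" and \<pi>: "\<pi> permutes E"
  shows "card {i \<in> tuples E :: ('a \<Rightarrow> 'n :: finite) set. i \<circ> \<pi> = i} = CARD('n) ^ num_cycles E \<pi>"
proof -
  let ?O = "orbit \<pi> ` E"
  have self: "x \<in> orbit \<pi> x" for x
    using E \<pi> by (rule self_in_orbit_permutes)
  have orb_eq: "orbit \<pi> (\<pi> x) = orbit \<pi> x" for x
    using E \<pi> by (intro permutation_orbit_step) (auto simp: permutation_permutes)
  define F :: "('a set \<Rightarrow> 'n) \<Rightarrow> 'a \<Rightarrow> 'n" where "F h = (\<lambda>x\<in>E. h (orbit \<pi> x))" for h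
  define G :: "('a \<Rightarrow> 'n) \<Rightarrow> 'a set \<Rightarrow> 'n" where "G i = (\<lambda>C\<in>?O. i (SOME x. x \<in> C))" for i
  have const: "i y = i x" if "i \<circ> \<pi> = i" "y \<in> orbit \<pi> x" for i :: "'a \<Rightarrow> 'n" and x y
    using that(2) by induction (use that(1) in \<open>auto simp: fun_eq_iff\<close>)
  have "bij_betw F (tuples ?O) {i \<in> tuples E. i \<circ> \<pi> = i}"
  proof (rule bij_betw_byWitness[where f' = G])
    show "\<forall>h\<in>tuples ?O. G (F h) = h"
    proof (intro ballI ext)
      fix h :: "'a set \<Rightarrow> 'n" and C assume h: "h \<in> tuples ?O"
      show "G (F h) C = h C"
      proof (cases "C \<in> ?O")
        case True
        then obtain x where x: "x \<in> E" "C = orbit \<pi> x" by auto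
        define y where "y = (SOME x. x \<in> C)"
        have y: "y \<in> orbit \<pi> x" unfolding y_def x(2) using self by (rule someI)
        moreover have "y \<in> E" using y permutes_orbit_subset[OF \<pi> x(1)] by auto
        moreover have "orbit \<pi> y = orbit \<pi> x"
          by (rule orbit_cyclic_eq3[OF _ y]) (use self in \<open>auto simp: cyclic_on_def\<close>)
        ultimately have "F h y = h C" using x(2) by (simp add: F_def)
        then show ?thesis using True by (simp add: G_def y_def)
      next
        case False
        then show ?thesis using PiE_arb[OF h False] by (simp add: G_def)
      qed
    qed
    show "\<forall>i\<in>{i \<in> tuples E. i \<circ> \<pi> = i}. F (G i) = i"
    proof (intro ballI ext)
      fix i :: "'a \<Rightarrow> 'n" and x assume i: "i \<in> {i \<in> tuples E. i \<circ> \<pi> = i}"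
      show "F (G i) x = i x"
      proof (cases "x \<in> E")
        case True
        have "(SOME y. y \<in> orbit \<pi> x) \<in> orbit \<pi> x" using self by (rule someI)
        then have "i (SOME y. y \<in> orbit \<pi> x) = i x" using i by (intro const) auto
        then show ?thesis using True by (simp add: F_def G_def)
      next
        case False
        then show ?thesis using i PiE_arb[of i E "\<lambda>_. UNIV" x] by (simp add: F_def)
      qed
    qed
    show "F ` tuples ?O \<subseteq> {i \<in> tuples E. i \<circ> \<pi> = i}"
    proof (intro image_subsetI CollectI conjI)
      fix h :: "'a set \<Rightarrow> 'n"
      show "F h \<in> tuples E" unfolding F_def by simp
      show "F h \<circ> \<pi> = F h"
        using permutes_in_image[OF \<pi>] by (simp add: F_def fun_eq_iff orb_eq)
    qed
    show "G ` {i \<in> tuples E. i \<circ> \<pi> = i} \<subseteq> tuples ?O"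
      by (auto simp: G_def)
  qed
  then have "card {i \<in> tuples E :: ('a \<Rightarrow> 'n) set. i \<circ> \<pi> = i} = card (tuples ?O :: ('a set \<Rightarrow> 'n) set)"
    by (rule bij_betw_same_card[symmetric])
  then show ?thesis using E by (simp add: card_funcsetE num_cycles_def)
qed

lemma num_cycles_conjugate:
  assumes f: "bij_betw f E E'" and \<pi>: "\<pi> permutes E"
    and comm: "\<And>x. x \<in> E \<Longrightarrow> f (\<pi> x) = \<pi>' (f x)"
  shows "num_cycles E' \<pi>' = num_cycles E \<pi>"
proof -
  have orb: "orbit \<pi>' (f x) = f ` orbit \<pi> x" if x: "x \<in> E" for x
  proof -
    have "(\<pi> ^^ k) x \<in> E \<and> (\<pi>' ^^ k) (f x) = f ((\<pi> ^^ k) x)" for k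
      by (induction k) (use x \<pi> in \<open>auto simp: comm permutes_in_image\<close>)
    then show ?thesis unfolding orbit_altdef by auto
  qed
  have "orbit \<pi>' ` E' = image f ` orbit \<pi> ` E"
    using f orb by (force simp: bij_betw_def image_image)
  moreover have "inj_on (image f) (orbit \<pi> ` E)"
  proof (rule inj_onI)
    fix A B assume "A \<in> orbit \<pi> ` E" "B \<in> orbit \<pi> ` E" "f ` A = f ` B"
    moreover from this have "A \<subseteq> E" "B \<subseteq> E" using permutes_orbit_subset[OF \<pi>] by blast+
    ultimately show "A = B" using f by (meson bij_betw_def inj_on_image_eq_iff)
  qed
  ultimately show ?thesis unfolding num_cycles_def by (simp add: card_image)
qed


section \<open>Weingarten coefficients invert the Gram matrix of the permutations\<close>

text \<open>
  Gaussian elimination over arbitrary finite index sets, since the systems below are indexed by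
  the permutations of a finite set and not by a finite type.
\<close>

lemma injective_square_system_solvable:
  fixes G :: "'r \<Rightarrow> 's \<Rightarrow> 'f :: field"
  assumes "finite S" "finite T" "card T = card S"
    and "\<And>f. (\<forall>t\<in>T. (\<Sum>s\<in>S. G t s * f s) = 0) \<Longrightarrow> \<forall>s\<in>S. f s = 0"
  shows "\<exists>f. \<forall>t\<in>T. (\<Sum>s\<in>S. G t s * f s) = y t"
  using assms
proof (induction S arbitrary: T G y rule: finite_induct)
  case empty
  then show ?case by simp
next
  case (insert s S)
  have "\<exists>t\<in>T. G t s \<noteq> 0"
  proof (rule ccontr)
    assume "\<not> ?thesis"
    then have z: "\<forall>t\<in>T. (\<Sum>r\<in>insert s S. G t r * (if r = s then 1 else 0)) = 0"
      using insert.hyps by (auto simp: if_distrib[where f = "\<lambda>c. _ * c"] cong: if_cong)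
    show False using insert.prems(3)[OF z] by simp
  qed
  then obtain t0 where t0: "t0 \<in> T" "G t0 s \<noteq> 0" by blast
  \<comment> \<open>Use row \<open>t0\<close> to eliminate the unknown of column \<open>s\<close> from all other rows.\<close>
  define G' where "G' t r = G t r - G t s / G t0 s * G t0 r" for t r
  define y' where "y' t = y t - G t s / G t0 s * y t0" for t
  define ext where "ext f z = f(s := (z - (\<Sum>r\<in>S. G t0 r * f r)) / G t0 s)" for f z
  have on_S: "(\<Sum>r\<in>S. G t r * ext f z r) = (\<Sum>r\<in>S. G t r * f r)" for f z t
    using insert.hyps by (intro sum.cong) (auto simp: ext_def)
  have ext0: "(\<Sum>r\<in>insert s S. G t0 r * ext f z r) = z" for f z
    using insert.hyps t0 by (simp add: on_S) (simp add: ext_def)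
  have ext: "(\<Sum>r\<in>insert s S. G t r * ext f z r) = (\<Sum>r\<in>S. G' t r * f r) + G t s / G t0 s * z"
    for f z t
  proof -
    have "(\<Sum>r\<in>S. G' t r * f r) = (\<Sum>r\<in>S. G t r * f r) - G t s / G t0 s * (\<Sum>r\<in>S. G t0 r * f r)"
      by (simp add: G'_def algebra_simps sum_subtractf sum_distrib_left)
    then show ?thesis
      using insert.hyps t0 by (simp add: on_S) (simp add: ext_def field_simps)
  qed
  have "\<exists>f. \<forall>t\<in>T - {t0}. (\<Sum>r\<in>S. G' t r * f r) = y' t"
  proof (rule insert.IH)
    show "card (T - {t0}) = card S" using insert t0 by simp
    fix f assume f: "\<forall>t\<in>T - {t0}. (\<Sum>r\<in>S. G' t r * f r) = 0"
    have "\<forall>t\<in>T. (\<Sum>r\<in>insert s S. G t r * ext f 0 r) = 0"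
      using f ext0[of f 0] ext[of _ f 0] by (metis DiffI add.right_neutral mult_zero_right singletonD)
    from insert.prems(3)[OF this] insert.hyps show "\<forall>r\<in>S. f r = 0"
      by (auto simp: ext_def split: if_splits)
  qed (use insert in auto)
  then obtain f where f: "\<forall>t\<in>T - {t0}. (\<Sum>r\<in>S. G' t r * f r) = y' t" ..
  have "(\<Sum>r\<in>insert s S. G t r * ext f (y t0) r) = y t" if "t \<in> T" for t
    using f that ext0[of f "y t0"] ext[of t f "y t0"] by (cases "t = t0") (auto simp: y'_def)
  then show ?case by blast
qed

text \<open>
  The trace of the operator \<open>\<tau> \<circ> inv \<sigma>\<close> on the tensor power counts the index tuples on which \<open>\<sigma>\<close>
  and \<open>\<tau>\<close> agree. So the coefficients of the cycle element are the inner products of the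
  permutation operators.
\<close>

lemma cycle_element_gram:
  fixes E :: "'a set"
  assumes E: "finite E" and \<sigma>: "\<sigma> permutes E" and \<tau>: "\<tau> permutes E"
  shows "cycle_element CARD('n :: finite) E (\<tau> \<circ> inv \<sigma>) =
    of_nat (card {i \<in> tuples E :: ('a \<Rightarrow> 'n :: finite) set. i \<circ> \<tau> = i \<circ> \<sigma>})"
proof -
  have "(i \<circ> \<tau> = i \<circ> \<sigma>) = (i \<circ> (\<tau> \<circ> inv \<sigma>) = i)" for i :: "'a \<Rightarrow> 'n"
    using tuple_comp_eq_iff[OF \<sigma>, of i "i \<circ> \<tau>"] by (auto simp: o_assoc)
  moreover have "(\<tau> \<circ> inv \<sigma>) permutes E" using \<sigma> \<tau> by (simp add: permutes_compose permutes_inv)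
  ultimately show ?thesis using E by (simp add: cycle_element_def card_tuples_fixed)
qed

text \<open>
  Conjugate permutations have equally many cycles, and \<open>\<tau>\<close> conjugates \<open>inv \<tau> \<circ> \<sigma>\<close> to
  \<open>\<sigma> \<circ> inv \<tau>\<close>.
\<close>

lemma cycle_element_central:
  assumes "\<sigma> permutes E" "\<tau> permutes E"
  shows "cycle_element N E (inv \<tau> \<circ> \<sigma>) = cycle_element N E (\<sigma> \<circ> inv \<tau>)"
proof -
  have p: "(inv \<tau> \<circ> \<sigma>) permutes E" "(\<sigma> \<circ> inv \<tau>) permutes E"
    using assms by (simp_all add: permutes_compose permutes_inv)
  have "num_cycles E (\<sigma> \<circ> inv \<tau>) = num_cycles E (inv \<tau> \<circ> \<sigma>)"
    by (rule num_cycles_conjugate[where f = \<tau>])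
      (use assms p in \<open>auto simp: permutes_imp_bij permutes_inverses\<close>)
  then show ?thesis using p by (simp add: cycle_element_def)
qed

lemma ga_mult_alt:
  assumes "\<sigma> permutes E"
  shows "ga_mult E f g \<sigma> = (\<Sum>\<rho> | \<rho> permutes E. f (\<sigma> \<circ> inv \<rho>) * g \<rho>)"
    and "ga_mult E f g \<sigma> = (\<Sum>\<tau> | \<tau> permutes E. f \<tau> * g (inv \<tau> \<circ> \<sigma>))"
proof -
  show "ga_mult E f g \<sigma> = (\<Sum>\<rho> | \<rho> permutes E. f (\<sigma> \<circ> inv \<rho>) * g \<rho>)" unfolding ga_mult_def
    by (rule sum.reindex_bij_witness[where i = "\<lambda>\<rho>. (\<sigma> \<circ> inv \<rho>, \<rho>)" and j = snd])
      (use assms in \<open>auto simp: o_assoc[symmetric] permutes_inv_o permutes_compose permutes_inv\<close>)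
  show "ga_mult E f g \<sigma> = (\<Sum>\<tau> | \<tau> permutes E. f \<tau> * g (inv \<tau> \<circ> \<sigma>))" unfolding ga_mult_def
    by (rule sum.reindex_bij_witness[where i = "\<lambda>\<tau>. (\<tau>, inv \<tau> \<circ> \<sigma>)" and j = fst])
      (use assms in \<open>auto simp: o_assoc permutes_inv_o permutes_compose permutes_inv\<close>)
qed

lemma ga_mult_not_permutes:
  assumes "\<not> \<sigma> permutes E"
  shows "ga_mult E f g \<sigma> = 0"
  using assms by (auto simp: ga_mult_def permutes_compose intro!: sum.neutral)

lemma cycle_element_commute: "ga_mult E f (cycle_element N E) = ga_mult E (cycle_element N E) f"
proof
  fix \<sigma>
  show "ga_mult E f (cycle_element N E) \<sigma> = ga_mult E (cycle_element N E) f \<sigma>"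
  proof (cases "\<sigma> permutes E")
    case True
    then show ?thesis
      by (simp add: ga_mult_alt(1)[OF True, of "cycle_element N E"] ga_mult_alt(2)[OF True, of f]
          cycle_element_central mult.commute)
  qed (simp add: ga_mult_not_permutes)
qed

lemma ex_inj_tuple:
  assumes "finite E" "card E \<le> CARD('n :: finite)"
  obtains j :: "'a \<Rightarrow> 'n :: finite" where "j \<in> tuples E" "inj_on j E"
proof -
  obtain f :: "'a \<Rightarrow> 'n" where "inj_on f E"
    using assms card_le_inj[of E "UNIV :: 'n set"] by auto
  then have "restrict f E \<in> tuples E" "inj_on (restrict f E) E" by auto
  then show ?thesis by (rule that)
qed

lemma comp_inj_tuple_eq_iff:
  assumes j: "inj_on j E" and \<sigma>: "\<sigma> permutes E" and \<tau>: "\<tau> permutes E"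
  shows "j \<circ> \<sigma> = j \<circ> \<tau> \<longleftrightarrow> \<sigma> = \<tau>"
proof
  assume eq: "j \<circ> \<sigma> = j \<circ> \<tau>"
  show "\<sigma> = \<tau>"
  proof
    fix x
    show "\<sigma> x = \<tau> x"
    proof (cases "x \<in> E")
      case True
      then show ?thesis using fun_cong[OF eq, of x] inj_onD[OF j] \<sigma> \<tau> by (auto simp: permutes_in_image)
    qed (use \<sigma> \<tau> in \<open>simp add: permutes_not_in\<close>)
  qed
qed simp

text \<open>
  The Gram matrix is nondegenerate: an element of its kernel is a linear combination of permutation
  operators of norm zero. Applied to a tensor product of distinct basis vectors, the permutation operators
  give different basis tensors, so all coefficients of the combination vanish. The bound on
  \<open>card E\<close> guarantees that there are enough basis vectors.
\<close>

lemma cycle_element_injective: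
  fixes E :: "'a set" and f :: "('a \<Rightarrow> 'a) \<Rightarrow> complex"
  assumes E: "finite E" "card E \<le> CARD('n :: finite)"
    and ker: "\<forall>\<tau>\<in>{\<tau>. \<tau> permutes E}.
      (\<Sum>\<sigma> | \<sigma> permutes E. cycle_element CARD('n) E (\<tau> \<circ> inv \<sigma>) * f \<sigma>) = 0"
  shows "\<forall>\<rho>\<in>{\<rho>. \<rho> permutes E}. f \<rho> = 0"
proof -
  let ?P = "{\<sigma>. \<sigma> permutes E}" and ?T = "tuples E :: ('a \<Rightarrow> 'n) set"
  have fin: "finite ?P" "finite ?T" using E by (auto simp: finite_permutations)
  define v where "v i i' = (\<Sum>\<sigma>\<in>?P. f \<sigma> * (if i \<circ> \<sigma> = i' then 1 else 0))" for i i' :: "'a \<Rightarrow> 'n"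
  \<comment> \<open>The squared norm of the operator \<open>\<Sum>\<sigma>. f \<sigma> \<cdot> \<sigma>\<close> is the Hermitian form of the Gram matrix.\<close>
  have "(\<Sum>i\<in>?T. \<Sum>i'\<in>?T. cnj (v i i') * v i i') =
      (\<Sum>i\<in>?T. \<Sum>i'\<in>?T. \<Sum>\<tau>\<in>?P. \<Sum>\<sigma>\<in>?P. cnj (f \<tau>) * f \<sigma> * (if i \<circ> \<tau> = i' \<and> i \<circ> \<sigma> = i' then 1 else 0))"
    unfolding v_def cnj_sum sum_product
    by (intro sum.cong refl) auto
  also have "\<dots> = (\<Sum>i\<in>?T. \<Sum>\<tau>\<in>?P. \<Sum>\<sigma>\<in>?P. cnj (f \<tau>) * f \<sigma> * (if i \<circ> \<tau> = i \<circ> \<sigma> then 1 else 0))"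
  proof (rule sum.cong[OF refl])
    fix i assume i: "i \<in> ?T"
    have "(\<Sum>i'\<in>?T. \<Sum>\<tau>\<in>?P. \<Sum>\<sigma>\<in>?P. cnj (f \<tau>) * f \<sigma> * (if i \<circ> \<tau> = i' \<and> i \<circ> \<sigma> = i' then 1 else 0)) =
      (\<Sum>\<tau>\<in>?P. \<Sum>\<sigma>\<in>?P. \<Sum>i'\<in>?T. cnj (f \<tau>) * f \<sigma> * (if i \<circ> \<tau> = i' \<and> i \<circ> \<sigma> = i' then 1 else 0))"
      by (subst sum.swap, rule sum.cong[OF refl], rule sum.swap)
    also have "\<dots> = (\<Sum>\<tau>\<in>?P. \<Sum>\<sigma>\<in>?P. cnj (f \<tau>) * f \<sigma> * (if i \<circ> \<tau> = i \<circ> \<sigma> then 1 else 0))"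
    proof (intro sum.cong refl)
      fix \<tau> \<sigma> assume "\<tau> \<in> ?P" "\<sigma> \<in> ?P"
      then have m: "i \<circ> \<tau> \<in> ?T" using tuple_comp_permutes[OF i] by blast
      have "(\<Sum>i'\<in>?T. cnj (f \<tau>) * f \<sigma> * (if i \<circ> \<tau> = i' \<and> i \<circ> \<sigma> = i' then 1 else 0)) =
        (\<Sum>i'\<in>?T. if i' = i \<circ> \<tau> then cnj (f \<tau>) * f \<sigma> * (if i \<circ> \<tau> = i \<circ> \<sigma> then 1 else 0) else 0)"
        by (intro sum.cong) auto
      then show "(\<Sum>i'\<in>?T. cnj (f \<tau>) * f \<sigma> * (if i \<circ> \<tau> = i' \<and> i \<circ> \<sigma> = i' then 1 else 0)) =
        cnj (f \<tau>) * f \<sigma> * (if i \<circ> \<tau> = i \<circ> \<sigma> then 1 else 0)"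
        using m fin by simp
    qed
    finally show "(\<Sum>i'\<in>?T. \<Sum>\<tau>\<in>?P. \<Sum>\<sigma>\<in>?P. cnj (f \<tau>) * f \<sigma> * (if i \<circ> \<tau> = i' \<and> i \<circ> \<sigma> = i' then 1 else 0)) =
      (\<Sum>\<tau>\<in>?P. \<Sum>\<sigma>\<in>?P. cnj (f \<tau>) * f \<sigma> * (if i \<circ> \<tau> = i \<circ> \<sigma> then 1 else 0))" .
  qed
  also have "\<dots> = (\<Sum>\<tau>\<in>?P. \<Sum>\<sigma>\<in>?P. \<Sum>i\<in>?T. cnj (f \<tau>) * f \<sigma> * (if i \<circ> \<tau> = i \<circ> \<sigma> then 1 else 0))"
    by (subst sum.swap, rule sum.cong[OF refl], rule sum.swap)
  also have "\<dots> = (\<Sum>\<tau>\<in>?P. cnj (f \<tau>) * (\<Sum>\<sigma>\<in>?P. cycle_element CARD('n) E (\<tau> \<circ> inv \<sigma>) * f \<sigma>))"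
    unfolding sum_distrib_left
  proof (intro sum.cong refl)
    fix \<tau> \<sigma> assume st: "\<tau> \<in> ?P" "\<sigma> \<in> ?P"
    have "(\<Sum>i\<in>?T. if i \<circ> \<tau> = i \<circ> \<sigma> then 1 else 0) = cycle_element CARD('n) E (\<tau> \<circ> inv \<sigma>)"
      using st E fin by (simp add: cycle_element_gram sum.If_cases Int_def)
    then show "(\<Sum>i\<in>?T. cnj (f \<tau>) * f \<sigma> * (if i \<circ> \<tau> = i \<circ> \<sigma> then 1 else 0)) =
      cnj (f \<tau>) * (cycle_element CARD('n) E (\<tau> \<circ> inv \<sigma>) * f \<sigma>)"
      by (simp add: sum_distrib_left[symmetric] mult.assoc mult.left_commute mult.commute)
  qed
  also have "\<dots> = 0" using ker by simp
  finally have "complex_of_real (\<Sum>i\<in>?T. \<Sum>i'\<in>?T. (cmod (v i i'))\<^sup>2) = 0"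
    by (simp only: of_real_sum complex_norm_square mult.commute)
  then have zero: "v i i' = 0" if "i \<in> ?T" "i' \<in> ?T" for i i'
    using that fin by (simp add: sum_nonneg_eq_0_iff sum_nonneg del: of_real_sum PiE_iff)
  obtain j :: "'a \<Rightarrow> 'n" where j: "j \<in> tuples E" "inj_on j E" using ex_inj_tuple[OF E] .
  show ?thesis
  proof
    fix \<rho> assume \<rho>: "\<rho> \<in> ?P"
    have "v j (j \<circ> \<rho>) = (\<Sum>\<sigma>\<in>?P. if \<sigma> = \<rho> then f \<rho> else 0)" unfolding v_def
      using comp_inj_tuple_eq_iff[OF j(2)] \<rho> by (intro sum.cong) auto
    also have "\<dots> = f \<rho>" using \<rho> fin by simp
    finally show "f \<rho> = 0" using zero[OF j(1) tuple_comp_permutes[OF j(1)]] \<rho> by simp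
  qed
qed

lemma weingarten_inverse:
  fixes E :: "'a set"
  assumes E: "finite E" "card E \<le> CARD('n :: finite)"
  shows "ga_mult E (weingarten CARD('n) E) (cycle_element CARD('n) E) = ga_one"
proof -
  let ?P = "{\<sigma>. \<sigma> permutes E}" and ?C = "cycle_element CARD('n) E"
  have fin: "finite ?P" using E by (auto simp: finite_permutations)
  have "\<exists>f. \<forall>\<tau>\<in>?P. (\<Sum>\<sigma>\<in>?P. ?C (\<tau> \<circ> inv \<sigma>) * f \<sigma>) = ga_one \<tau>"
    by (rule injective_square_system_solvable[OF fin fin refl]) (rule cycle_element_injective[OF E])
  then obtain f where f: "\<forall>\<tau>\<in>?P. (\<Sum>\<sigma>\<in>?P. ?C (\<tau> \<circ> inv \<sigma>) * f \<sigma>) = ga_one \<tau>" ..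
  define W where "W \<sigma> = (if \<sigma> \<in> ?P then f \<sigma> else 0)" for \<sigma>
  have W: "W \<in> group_algebra E" by (auto simp: group_algebra_def W_def)
  have CW: "ga_mult E ?C W = ga_one"
  proof
    fix \<tau>
    show "ga_mult E ?C W \<tau> = ga_one \<tau>"
      using f by (cases "\<tau> permutes E")
        (auto simp: ga_mult_alt(1) W_def ga_mult_not_permutes ga_one_def permutes_id)
  qed
  have uniq: "V = W" if V: "V \<in> group_algebra E" "ga_mult E ?C V = ga_one" for V
  proof -
    have "\<forall>\<tau>\<in>?P. (\<Sum>\<sigma>\<in>?P. ?C (\<tau> \<circ> inv \<sigma>) * (V \<sigma> - W \<sigma>)) = 0"
    proof
      fix \<tau> assume "\<tau> \<in> ?P"
      then show "(\<Sum>\<sigma>\<in>?P. ?C (\<tau> \<circ> inv \<sigma>) * (V \<sigma> - W \<sigma>)) = 0"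
        using fun_cong[OF V(2), of \<tau>] fun_cong[OF CW, of \<tau>]
        by (simp add: ga_mult_alt(1) right_diff_distrib sum_subtractf)
    qed
    from cycle_element_injective[OF E this] have eq: "V \<sigma> = W \<sigma>" if "\<sigma> permutes E" for \<sigma>
      using that by simp
    show ?thesis
    proof
      fix \<sigma>
      show "V \<sigma> = W \<sigma>"
        using V(1) W eq by (cases "\<sigma> permutes E") (auto simp: group_algebra_def)
    qed
  qed
  have "weingarten CARD('n) E = W" unfolding weingarten_def
  proof (rule the_equality)
    show "W \<in> group_algebra E \<and> ga_mult E ?C W = ga_one \<and> ga_mult E W ?C = ga_one"
      using W CW by (simp add: cycle_element_commute)
  qed (blast intro: uniq)
  then show ?thesis using CW by (simp add: cycle_element_commute)
qed

text \<open>
  The form in which the Weingarten coefficients enter the integration formula: they solve every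
  linear system whose matrix is the Gram matrix of the permutation operators.
\<close>

lemma gram_system_solution:
  fixes E :: "'a set" and c t :: "('a \<Rightarrow> 'a) \<Rightarrow> complex"
  assumes E: "finite E" "card E \<le> CARD('n :: finite)"
    and sys: "\<And>\<tau>. \<tau> permutes E \<Longrightarrow>
      (\<Sum>\<sigma> | \<sigma> permutes E. cycle_element CARD('n) E (\<tau> \<circ> inv \<sigma>) * c \<sigma>) = t \<tau>"
    and \<rho>: "\<rho> permutes E"
  shows "c \<rho> = (\<Sum>\<tau> | \<tau> permutes E. weingarten CARD('n) E (\<rho> \<circ> inv \<tau>) * t \<tau>)"
proof -
  let ?P = "{\<sigma>. \<sigma> permutes E}" and ?C = "cycle_element CARD('n) E"
    and ?W = "weingarten CARD('n) E"
  have fin: "finite ?P" using E by (auto simp: finite_permutations)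
  have inverse: "(\<Sum>\<tau>\<in>?P. ?W (\<rho> \<circ> inv \<tau>) * ?C (\<tau> \<circ> inv \<sigma>)) = (if \<rho> = \<sigma> then 1 else 0)"
    if \<sigma>: "\<sigma> permutes E" for \<sigma>
  proof -
    have p: "(\<rho> \<circ> inv \<sigma>) permutes E" using \<rho> \<sigma> by (simp add: permutes_compose permutes_inv)
    have "ga_one (\<rho> \<circ> inv \<sigma>) = ga_mult E ?W ?C (\<rho> \<circ> inv \<sigma>)"
      by (simp add: weingarten_inverse[OF E])
    also have "\<dots> = (\<Sum>\<pi>\<in>?P. ?W (\<rho> \<circ> inv \<sigma> \<circ> inv \<pi>) * ?C \<pi>)" by (rule ga_mult_alt(1)[OF p])
    also have "\<dots> = (\<Sum>\<tau>\<in>?P. ?W (\<rho> \<circ> inv \<tau>) * ?C (\<tau> \<circ> inv \<sigma>))"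
    proof (rule sum.reindex_bij_witness[where i = "\<lambda>\<tau>. \<tau> \<circ> inv \<sigma>" and j = "\<lambda>\<pi>. \<pi> \<circ> \<sigma>"])
      fix \<pi> assume "\<pi> \<in> ?P"
      then have "inv (\<pi> \<circ> \<sigma>) = inv \<sigma> \<circ> inv \<pi>"
        using \<sigma> by (intro o_inv_distrib) (auto simp: permutes_bij)
      then show "?W (\<rho> \<circ> inv (\<pi> \<circ> \<sigma>)) * ?C (\<pi> \<circ> \<sigma> \<circ> inv \<sigma>) =
        ?W (\<rho> \<circ> inv \<sigma> \<circ> inv \<pi>) * ?C \<pi>"
        using \<sigma> by (simp add: o_assoc[symmetric] permutes_inv_o)
    qed (use \<sigma> in \<open>auto simp: o_assoc[symmetric] permutes_inv_o permutes_compose permutes_inv\<close>)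
    finally have "(\<Sum>\<tau>\<in>?P. ?W (\<rho> \<circ> inv \<tau>) * ?C (\<tau> \<circ> inv \<sigma>)) = ga_one (\<rho> \<circ> inv \<sigma>)" ..
    moreover have "\<rho> \<circ> inv \<sigma> = id \<longleftrightarrow> \<rho> = \<sigma>"
      using tuple_comp_eq_iff[OF \<sigma>, of id \<rho>] by auto
    ultimately show ?thesis by (simp add: ga_one_def)
  qed
  have "(\<Sum>\<tau>\<in>?P. ?W (\<rho> \<circ> inv \<tau>) * t \<tau>) =
      (\<Sum>\<tau>\<in>?P. \<Sum>\<sigma>\<in>?P. ?W (\<rho> \<circ> inv \<tau>) * ?C (\<tau> \<circ> inv \<sigma>) * c \<sigma>)"
    by (intro sum.cong refl) (simp add: sys[symmetric] sum_distrib_left mult.assoc)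
  also have "\<dots> = (\<Sum>\<sigma>\<in>?P. (\<Sum>\<tau>\<in>?P. ?W (\<rho> \<circ> inv \<tau>) * ?C (\<tau> \<circ> inv \<sigma>)) * c \<sigma>)"
    by (subst sum.swap) (simp add: sum_distrib_right)
  also have "\<dots> = (\<Sum>\<sigma>\<in>?P. if \<rho> = \<sigma> then c \<sigma> else 0)"
    by (intro sum.cong refl) (simp add: inverse)
  also have "\<dots> = c \<rho>" using fin \<rho> by simp
  finally show ?thesis ..
qed

section \<open>The commutant of the tensor powers of the unitary group\<close>

text \<open>
  The matrix entries of the tensor power of \<open>A\<close> with one factor for each element of \<open>E\<close>; rows and
  columns are indexed by \<open>tuples E\<close>.
\<close>

definition kron_power :: "'a set \<Rightarrow> complex ^ 'n ^ 'n \<Rightarrow> ('a \<Rightarrow> 'n) \<Rightarrow> ('a \<Rightarrow> 'n) \<Rightarrow> complex" where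
  "kron_power E A i j = (\<Prod>e\<in>E. A $ i e $ j e)"

definition commutes_power ::
    "'a set \<Rightarrow> (('a \<Rightarrow> 'n) \<Rightarrow> ('a \<Rightarrow> 'n) \<Rightarrow> complex) \<Rightarrow> complex ^ 'n ^ 'n \<Rightarrow> bool" where
  "commutes_power E T A \<longleftrightarrow> (\<forall>i\<in>tuples E. \<forall>j\<in>tuples E.
     (\<Sum>p\<in>tuples E. T i p * kron_power E A p j) = (\<Sum>p\<in>tuples E. kron_power E A i p * T p j))"

lemma kron_power_mult:
  fixes A B :: "complex ^ 'n ^ 'n"
  assumes "finite E"
  shows "(\<Sum>p\<in>tuples E. kron_power E A i p * kron_power E B p j) = kron_power E (A ** B) i j"
proof -
  have "kron_power E (A ** B) i j = (\<Prod>e\<in>E. \<Sum>k\<in>UNIV. A $ i e $ k * B $ k $ j e)"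
    by (simp add: kron_power_def matrix_matrix_mult_def)
  also have "\<dots> = (\<Sum>p\<in>tuples E. \<Prod>e\<in>E. A $ i e $ p e * B $ p e $ j e)"
    using assms by (rule prod_sum_PiE) auto
  finally show ?thesis by (simp add: kron_power_def prod.distrib)
qed

lemma commutes_power_mult:
  fixes A B :: "complex ^ 'n ^ 'n"
  assumes E: "finite E" and A: "commutes_power E T A" and B: "commutes_power E T B"
  shows "commutes_power E T (A ** B)"
  unfolding commutes_power_def
proof (intro ballI)
  fix i j :: "'a \<Rightarrow> 'n" assume i: "i \<in> tuples E" and j: "j \<in> tuples E"
  let ?K = "kron_power E" and ?S = "tuples E :: ('a \<Rightarrow> 'n) set"
  have "(\<Sum>p\<in>?S. T i p * ?K (A ** B) p j) = (\<Sum>p\<in>?S. \<Sum>r\<in>?S. T i p * ?K A p r * ?K B r j)"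
    by (simp add: kron_power_mult[OF E, symmetric] sum_distrib_left mult.assoc)
  also have "\<dots> = (\<Sum>r\<in>?S. (\<Sum>p\<in>?S. T i p * ?K A p r) * ?K B r j)"
    by (subst sum.swap) (simp add: sum_distrib_right)
  also have "\<dots> = (\<Sum>r\<in>?S. (\<Sum>p\<in>?S. ?K A i p * T p r) * ?K B r j)"
    using A i by (simp add: commutes_power_def del: PiE_iff)
  also have "\<dots> = (\<Sum>p\<in>?S. ?K A i p * (\<Sum>r\<in>?S. T p r * ?K B r j))"
    unfolding sum_distrib_right sum_distrib_left by (subst sum.swap) (simp add: mult.assoc)
  also have "\<dots> = (\<Sum>p\<in>?S. ?K A i p * (\<Sum>r\<in>?S. ?K B p r * T r j))"
    using B j by (simp add: commutes_power_def del: PiE_iff)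
  also have "\<dots> = (\<Sum>r\<in>?S. (\<Sum>p\<in>?S. ?K A i p * ?K B p r) * T r j)"
    unfolding sum_distrib_right sum_distrib_left by (subst sum.swap) (simp add: mult.assoc)
  finally show "(\<Sum>p\<in>?S. T i p * ?K (A ** B) p j) = (\<Sum>p\<in>?S. ?K (A ** B) i p * T p j)"
    by (simp add: kron_power_mult[OF E])
qed

definition diagonal_matrix :: "('n \<Rightarrow> complex) \<Rightarrow> complex ^ 'n ^ 'n" where
  "diagonal_matrix d = (\<chi> a b. if a = b then d a else 0)"

definition function_matrix :: "('n \<Rightarrow> 'n) \<Rightarrow> complex ^ 'n ^ 'n" where
  "function_matrix \<phi> = (\<chi> a b. if a = \<phi> b then 1 else 0)"

lemma tuples_eqI: "i \<in> tuples E \<Longrightarrow> j \<in> tuples E \<Longrightarrow> (\<And>e. e \<in> E \<Longrightarrow> i e = j e) \<Longrightarrow> i = j"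
  by (rule PiE_ext)

lemma kron_power_diagonal:
  assumes "finite E" "i \<in> tuples E" "j \<in> tuples E"
  shows "kron_power E (diagonal_matrix d) i j = (if i = j then \<Prod>e\<in>E. d (i e) else 0)"
proof (cases "i = j")
  case False
  then obtain e where "e \<in> E" "i e \<noteq> j e" using assms tuples_eqI by blast
  then have "kron_power E (diagonal_matrix d) i j = 0"
    using assms(1) unfolding kron_power_def by (intro prod_zero) (auto simp: diagonal_matrix_def)
  then show ?thesis using False by simp
qed (simp add: kron_power_def diagonal_matrix_def)

lemma kron_power_map:
  assumes "finite E" "i \<in> tuples E"
  shows "kron_power E (function_matrix \<phi>) i j = (if i = restrict (\<phi> \<circ> j) E then 1 else 0)"
proof (cases "i = restrict (\<phi> \<circ> j) E")
  case False
  moreover have "restrict (\<phi> \<circ> j) E \<in> tuples E" by simp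
  ultimately obtain e where "e \<in> E" "i e \<noteq> restrict (\<phi> \<circ> j) E e"
    using assms tuples_eqI by blast
  then have "kron_power E (function_matrix \<phi>) i j = 0"
    using assms(1) unfolding kron_power_def by (intro prod_zero) (auto simp: function_matrix_def)
  then show ?thesis using False by simp
qed (simp add: kron_power_def function_matrix_def)

lemma function_matrix_comp: "function_matrix (\<phi> \<circ> \<psi>) = function_matrix \<phi> ** function_matrix \<psi>"
proof -
  have "(\<Sum>k\<in>UNIV. (if a = \<phi> k then 1 else 0) * (if k = \<psi> b then 1 else 0)) =
      (\<Sum>k\<in>UNIV. if k = \<psi> b then (if a = \<phi> k then 1 else 0) else (0 :: complex))" for a b
    by (intro sum.cong) auto
  then show ?thesis by (simp add: function_matrix_def matrix_matrix_mult_def vec_eq_iff)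
qed

lemma commutes_power_diagonal_iff:
  fixes T :: "('a \<Rightarrow> 'n :: finite) \<Rightarrow> ('a \<Rightarrow> 'n) \<Rightarrow> complex"
  assumes E: "finite E"
  shows "commutes_power E T (diagonal_matrix d) \<longleftrightarrow>
    (\<forall>i\<in>tuples E. \<forall>j\<in>tuples E. T i j * (\<Prod>e\<in>E. d (j e)) = (\<Prod>e\<in>E. d (i e)) * T i j)"
proof -
  let ?S = "tuples E :: ('a \<Rightarrow> 'n) set"
  have fin: "finite ?S" using E by simp
  have "(\<Sum>p\<in>?S. T i p * kron_power E (diagonal_matrix d) p j) = T i j * (\<Prod>e\<in>E. d (j e))"
    if "j \<in> ?S" for i j
  proof -
    have "(\<Sum>p\<in>?S. T i p * kron_power E (diagonal_matrix d) p j) =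
      (\<Sum>p\<in>?S. if p = j then T i j * (\<Prod>e\<in>E. d (j e)) else 0)"
      by (intro sum.cong refl) (use that in \<open>simp add: kron_power_diagonal[OF E] del: PiE_iff\<close>)
    then show ?thesis using fin that by simp
  qed
  moreover have "(\<Sum>p\<in>?S. kron_power E (diagonal_matrix d) i p * T p j) = (\<Prod>e\<in>E. d (i e)) * T i j"
    if "i \<in> ?S" for i j
  proof -
    have "(\<Sum>p\<in>?S. kron_power E (diagonal_matrix d) i p * T p j) =
      (\<Sum>p\<in>?S. if p = i then (\<Prod>e\<in>E. d (i e)) * T i j else 0)"
      by (intro sum.cong refl) (use that in \<open>auto simp add: kron_power_diagonal[OF E] simp del: PiE_iff\<close>)
    then show ?thesis using fin that by simp
  qed
  ultimately show ?thesis unfolding commutes_power_def by simp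
qed

lemma diagonal_matrix_unitary:
  assumes "\<And>a. cmod (d a) = 1"
  shows "diagonal_matrix d \<in> (unitary_group :: (complex ^ 'n ^ 'n) set)"
proof -
  have d: "cnj (d a) * d a = 1" "d a * cnj (d a) = 1" for a
    using assms[of a] complex_norm_square[of "d a"] by (simp_all add: mult.commute)
  have "conj_transpose (diagonal_matrix d) = (diagonal_matrix (\<lambda>a. cnj (d a)) :: complex ^ 'n ^ 'n)"
    by (auto simp: conj_transpose_def diagonal_matrix_def vec_eq_iff)
  then show ?thesis
    by (simp add: unitary_group_def matrix_matrix_mult_def diagonal_matrix_def vec_eq_iff mat_def
        if_distrib[where f = "\<lambda>c. _ * c"] d cong: if_cong)
qed

lemma function_matrix_unitary:
  fixes \<pi> :: "'n :: finite \<Rightarrow> 'n"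
  assumes "bij \<pi>"
  shows "function_matrix \<pi> \<in> unitary_group"
proof -
  have "conj_transpose (function_matrix \<pi>) = function_matrix (inv \<pi>)"
    using assms by (auto simp: conj_transpose_def function_matrix_def vec_eq_iff bij_is_inj
        bij_is_surj surj_f_inv_f)
  moreover have "function_matrix id = (mat 1 :: complex ^ 'n ^ 'n)"
    by (simp add: function_matrix_def mat_def)
  ultimately show ?thesis using assms
    by (simp add: unitary_group_def function_matrix_comp[symmetric] bij_is_inj surj_iff[THEN iffD1] bij_is_surj)
qed

text \<open>
  Commuting with diagonal matrices means preserving weights. A diagonal entry \<open>z\<close> of absolute value
  \<open>1\<close> in one place shows that the multiplicities of this index in \<open>i\<close> and in \<open>j\<close> give the same
  power of \<open>z\<close>. If the multiplicities were different, a suitable root of \<open>-1\<close> would tell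
  them apart.
\<close>

lemma same_content_if_commutes_unitary_diagonals:
  fixes T :: "('a \<Rightarrow> 'n :: finite) \<Rightarrow> ('a \<Rightarrow> 'n) \<Rightarrow> complex"
  assumes E: "finite E" and comm: "\<And>U. U \<in> unitary_group \<Longrightarrow> commutes_power E T U"
    and i: "i \<in> tuples E" and j: "j \<in> tuples E" and nz: "T i j \<noteq> 0"
  shows "card {e \<in> E. i e = a} = card {e \<in> E. j e = a}"
proof -
  have power: "z ^ card {e \<in> E. i e = a} = z ^ card {e \<in> E. j e = a}" if z: "cmod z = 1" for z
  proof -
    define d where "d b = (if b = a then z else 1)" for b
    have "(\<Prod>e\<in>E. d (l e)) = z ^ card {e \<in> E. l e = a}" for l
      using E by (simp add: d_def prod.If_cases Int_def)
    moreover have "commutes_power E T (diagonal_matrix d)"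
      by (intro comm diagonal_matrix_unitary) (simp add: d_def z)
    ultimately have "T i j * z ^ card {e \<in> E. j e = a} = z ^ card {e \<in> E. i e = a} * T i j"
      using i j unfolding commutes_power_diagonal_iff[OF E] by metis
    then show ?thesis using nz by simp
  qed
  have less: False if "m < k" "\<And>z. cmod z = 1 \<Longrightarrow> z ^ m = z ^ k" for m k :: nat
  proof -
    \<comment> \<open>Then \<open>?z ^ (k - m) = -1\<close>, so the powers of \<open>?z\<close> with exponents \<open>m\<close> and \<open>k\<close> differ.\<close>
    let ?z = "cis (pi / real (k - m))"
    have "?z ^ k = ?z ^ m * ?z ^ (k - m)" using that(1) by (simp flip: power_add)
    also have "?z ^ (k - m) = -1" using that(1) by (simp add: Complex.DeMoivre)
    finally have "?z ^ m = - (?z ^ m)" using that(2)[of ?z] by simp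
    then have "2 * ?z ^ m = 0" by (simp only: mult_2 eq_neg_iff_add_eq_0)
    then show False by simp
  qed
  show ?thesis
  proof (rule linorder_cases)
    assume "card {e \<in> E. i e = a} < card {e \<in> E. j e = a}"
    then show ?thesis using less[OF _ power] by blast
  next
    assume "card {e \<in> E. i e = a} > card {e \<in> E. j e = a}"
    then show ?thesis using less[OF _ power[symmetric]] by blast
  qed
qed

text \<open>
  The product of diagonal entries along a tuple depends only on the multiplicities of the indices, so it
  does not matter that the entries need not have absolute value \<open>1\<close>. This is where
  the argument leaves the unitary group.
\<close>

lemma commutes_power_diagonal:
  fixes T :: "('a \<Rightarrow> 'n :: finite) \<Rightarrow> ('a \<Rightarrow> 'n) \<Rightarrow> complex"
  assumes E: "finite E" and comm: "\<And>U. U \<in> unitary_group \<Longrightarrow> commutes_power E T U"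
  shows "commutes_power E T (diagonal_matrix d)"
proof -
  have content: "(\<Prod>e\<in>E. d (l e)) = (\<Prod>a\<in>UNIV. d a ^ card {e \<in> E. l e = a})" for l :: "'a \<Rightarrow> 'n"
  proof -
    have "(\<Prod>e\<in>E. d (l e)) = (\<Prod>a\<in>UNIV. \<Prod>e\<in>{e \<in> E. l e = a}. d (l e))"
      using E by (intro prod.group[symmetric]) auto
    then show ?thesis by simp
  qed
  have "T i j * (\<Prod>e\<in>E. d (j e)) = (\<Prod>e\<in>E. d (i e)) * T i j"
    if "i \<in> tuples E" "j \<in> tuples E" for i j
    using same_content_if_commutes_unitary_diagonals[OF E comm that]
    by (cases "T i j = 0") (simp_all add: content)
  then show ?thesis by (simp add: commutes_power_diagonal_iff[OF E] del: PiE_iff)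
qed

text \<open>
  Both basis vectors \<open>e\<^sub>x\<close> and \<open>e\<^sub>y\<close> have to be sent to \<open>e\<^sub>y\<close>. A reflection of the plane that they span
  sends them to \<open>(e\<^sub>y - e\<^sub>x) / sqrt 2\<close> and \<open>(e\<^sub>y + e\<^sub>x) / sqrt 2\<close>, and a diagonal matrix then removes the
  component along \<open>e\<^sub>x\<close> and rescales the other one.
\<close>

lemma collapse_factorization:
  fixes x y :: "'n :: finite"
  assumes xy: "x \<noteq> y"
  obtains d and U :: "complex ^ 'n ^ 'n"
  where "U \<in> unitary_group" "function_matrix (id(x := y)) = diagonal_matrix d ** U"
proof -
  let ?c = "complex_of_real (1 / sqrt 2)"
  have c2: "?c * ?c = 1 / 2" "complex_of_real (sqrt 2) * ?c = 1"
    by (simp_all flip: of_real_mult)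
  define h where "h a b = (if a = x \<and> b = x then - ?c else if a \<in> {x, y} \<and> b \<in> {x, y} then ?c
    else if a = b then 1 else 0)" for a b
  define U :: "complex ^ 'n ^ 'n" where "U = (\<chi> a b. h a b)"
  define d where "d a = (if a = x then 0 else if a = y then complex_of_real (sqrt 2) else 1)" for a
  have "conj_transpose U = U"
    by (simp add: conj_transpose_def U_def h_def vec_eq_iff)
  moreover have "U ** U = mat 1"
  proof -
    have split: "UNIV = insert x (insert y (UNIV - {x, y}))" by auto
    have "(\<Sum>k\<in>UNIV. h a k * h k b) = (if a = b then 1 else 0)" for a b
    proof -
      have "(\<Sum>k\<in>UNIV. h a k * h k b) = h a x * h x b + h a y * h y b
          + (\<Sum>k\<in>UNIV - {x, y}. h a k * h k b)"
        using xy by (subst split) (simp add: add.assoc)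
      also have "(\<Sum>k\<in>UNIV - {x, y}. h a k * h k b) =
          (\<Sum>k\<in>UNIV - {x, y}. if k = a then (if a = b then 1 else 0) else 0)"
        by (intro sum.cong) (auto simp: h_def)
      also have "\<dots> = (if a \<in> {x, y} then 0 else if a = b then 1 else 0)"
        by auto
      finally show ?thesis using xy c2 by (auto simp: h_def)
    qed
    then show ?thesis by (simp add: U_def matrix_matrix_mult_def mat_def vec_eq_iff)
  qed
  ultimately have "U \<in> unitary_group" by (simp add: unitary_group_def)
  moreover have "function_matrix (id(x := y)) = diagonal_matrix d ** U"
  proof -
    have "(\<Sum>k\<in>UNIV. (if a = k then d a else 0) * h k b) = d a * h a b" for a b
      by (simp add: if_distrib[where f = "\<lambda>c. c * _"] cong: if_cong)
    moreover have "d a * h a b = (if a = (id(x := y)) b then 1 else 0)" for a b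
      using xy c2 by (auto simp: d_def h_def)
    ultimately show ?thesis
      by (simp add: function_matrix_def diagonal_matrix_def U_def matrix_matrix_mult_def vec_eq_iff)
  qed
  ultimately show ?thesis by (rule that)
qed

text \<open>
  Every self-map of a finite set is a composition of permutations and of maps that move only one
  point. The induction is on the number of missed values: a noninjective \<open>\<phi>\<close> is obtained from
  a map with one more value by moving that value.
\<close>

lemma commutes_power_map:
  fixes T :: "('a \<Rightarrow> 'n :: finite) \<Rightarrow> ('a \<Rightarrow> 'n) \<Rightarrow> complex" and \<phi> :: "'n \<Rightarrow> 'n"
  assumes E: "finite E" and comm: "\<And>U. U \<in> unitary_group \<Longrightarrow> commutes_power E T U"
  shows "commutes_power E T (function_matrix \<phi>)"
proof (induction "card (- range \<phi>)" arbitrary: \<phi> rule: less_induct)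
  case less
  show ?case
  proof (cases "inj \<phi>")
    case True
    then show ?thesis by (intro comm function_matrix_unitary) (simp add: finite_UNIV_inj_surj bij_def)
  next
    case False
    then obtain x y where xy: "x \<noteq> y" "\<phi> x = \<phi> y" by (auto simp: inj_on_def)
    from False have "\<not> surj \<phi>" by (auto simp: finite_UNIV_surj_inj)
    then obtain z where z: "z \<notin> range \<phi>" by blast
    \<comment> \<open>Separate \<open>x\<close> and \<open>y\<close> with the help of the missed value \<open>z\<close>; moving \<open>z\<close> to \<open>\<phi> x\<close> restores \<open>\<phi>\<close>.\<close>
    define \<psi> where "\<psi> = \<phi>(y := z)"
    have "range \<psi> = insert z (range \<phi>)"
      using xy by (auto simp: \<psi>_def image_iff) metis+
    then have "card (- range \<psi>) < card (- range \<phi>)"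
      using z by (intro psubset_card_mono) auto
    then have "commutes_power E T (function_matrix \<psi>)" by (rule less)
    moreover have "commutes_power E T (function_matrix (id(z := \<phi> x)))"
    proof -
      have "z \<noteq> \<phi> x" using z by auto
      from collapse_factorization[OF this] show ?thesis
        using commutes_power_mult[OF E commutes_power_diagonal[OF E comm] comm] by metis
    qed
    moreover have "\<phi> = id(z := \<phi> x) \<circ> \<psi>"
      using xy z by (auto simp: \<psi>_def fun_eq_iff)
    ultimately show ?thesis
      using commutes_power_mult[OF E] function_matrix_comp by metis
  qed
qed

text \<open>
  An operator \<open>T\<close> in the commutant is determined by its values on the tensor product of distinct basis
  vectors \<open>l\<close>, because every other basis tensor is the image of this one under the tensor power of the
  matrix of a self-map of the index set, which commutes with \<open>T\<close>. By the comparison of weights,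
  \<open>T\<close> sends the tensor \<open>l\<close> to a combination of the tensors \<open>l \<circ> \<sigma>\<close>.
\<close>

theorem commutant_of_unitary_power:
  fixes T :: "('a \<Rightarrow> 'n :: finite) \<Rightarrow> ('a \<Rightarrow> 'n) \<Rightarrow> complex"
  assumes E: "finite E" "card E \<le> CARD('n)"
    and comm: "\<And>U. U \<in> unitary_group \<Longrightarrow> commutes_power E T U"
  obtains c where "\<And>i j. i \<in> tuples E \<Longrightarrow> j \<in> tuples E \<Longrightarrow>
    T i j = (\<Sum>\<sigma> | \<sigma> permutes E. if j \<circ> \<sigma> = i then c \<sigma> else 0)"
proof -
  let ?S = "tuples E :: ('a \<Rightarrow> 'n) set" and ?P = "{\<sigma>. \<sigma> permutes E}"
  have fin: "finite ?S" "finite ?P" using E by (auto simp: finite_permutations)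
  obtain l :: "'a \<Rightarrow> 'n" where l: "l \<in> tuples E" "inj_on l E" using ex_inj_tuple[OF E] .
  have perm: "\<exists>\<sigma>\<in>?P. p = l \<circ> \<sigma>" if p: "p \<in> ?S" "T p l \<noteq> 0" for p
  proof -
    have card1: "card {e \<in> E. p e = l e'} = 1" if "e' \<in> E" for e'
    proof -
      have "{e \<in> E. l e = l e'} = {e'}" using l(2) that by (auto dest: inj_onD)
      then have "card {e \<in> E. l e = l e'} = 1" by simp
      then show ?thesis
        using same_content_if_commutes_unitary_diagonals[where T = T, OF E(1) comm p(1) l(1) p(2), of "l e'"]
        by (rule trans[rotated])
    qed
    have inv: "p e \<in> l ` E" if "e \<in> E" for e
    proof (rule ccontr)
      assume "p e \<notin> l ` E"
      then have "{e' \<in> E. l e' = p e} = {}"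
        by (metis (mono_tags, lifting) Collect_empty_eq image_eqI)
      then have "card {e' \<in> E. p e' = p e} = 0"
        using same_content_if_commutes_unitary_diagonals[where T = T, OF E(1) comm p(1) l(1) p(2), of "p e"]
        by (simp only: card.empty)
      then show False using that E(1) by auto
    qed
    define \<sigma> where "\<sigma> e = (if e \<in> E then inv_into E l (p e) else e)" for e
    have in_E: "\<sigma> e \<in> E" "l (\<sigma> e) = p e" if "e \<in> E" for e
      using inv[OF that] that by (auto simp: \<sigma>_def inv_into_into f_inv_into_f)
    have "inj_on \<sigma> E"
    proof (rule inj_onI)
      fix e e' assume e: "e \<in> E" "e' \<in> E" "\<sigma> e = \<sigma> e'"
      then have "p e = l (\<sigma> e)" "p e' = l (\<sigma> e)" using in_E by metis+
      then have "{e, e'} \<subseteq> {e'' \<in> E. p e'' = l (\<sigma> e)}" using e by auto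
      moreover obtain e0 where "{e'' \<in> E. p e'' = l (\<sigma> e)} = {e0}"
        using card1[OF in_E(1)[OF e(1)]] by (auto simp: card_1_singleton_iff)
      ultimately show "e = e'" by auto
    qed
    then have "bij_betw \<sigma> E E"
      using in_E E(1) by (intro bij_betw_imageI endo_inj_surj) auto
    then have "\<sigma> permutes E" by (rule bij_imp_permutes) (simp add: \<sigma>_def)
    moreover from this have "p = l \<circ> \<sigma>"
      using in_E(2) by (intro tuples_eqI[OF p(1) tuple_comp_permutes[OF l(1)]]) auto
    ultimately show ?thesis by blast
  qed
  define c where "c \<sigma> = T (l \<circ> \<sigma>) l" for \<sigma>
  have "T i j = (\<Sum>\<sigma>\<in>?P. if j \<circ> \<sigma> = i then c \<sigma> else 0)" if i: "i \<in> ?S" and j: "j \<in> ?S" for i j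
  proof -
    \<comment> \<open>A matrix that sends the distinct basis vectors \<open>l e\<close> to the basis vectors \<open>j e\<close>.\<close>
    define \<phi> where "\<phi> = j \<circ> inv_into E l"
    have \<phi>: "\<phi> (l e) = j e" if "e \<in> E" for e using that l(2) by (simp add: \<phi>_def)
    have rj: "restrict (\<phi> \<circ> (l \<circ> \<sigma>)) E = j \<circ> \<sigma>" if "\<sigma> permutes E" for \<sigma>
      by (rule tuples_eqI[OF _ tuple_comp_permutes[OF j that]])
        (use that \<phi> in \<open>auto simp: permutes_in_image\<close>)
    from rj[OF permutes_id] have rid: "restrict (\<phi> \<circ> l) E = j" by simp
    have "T i j = (\<Sum>p\<in>?S. if p = j then T i p else 0)" using fin j by simp
    also have "\<dots> = (\<Sum>p\<in>?S. T i p * kron_power E (function_matrix \<phi>) p l)"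
      by (intro sum.cong refl) (simp add: kron_power_map[OF E(1)] rid del: PiE_iff)
    also have "\<dots> = (\<Sum>p\<in>?S. kron_power E (function_matrix \<phi>) i p * T p l)"
      using commutes_power_map[where \<phi> = \<phi>, OF E(1) comm] i l(1)
      by (simp add: commutes_power_def del: PiE_iff)
    also have "\<dots> = (\<Sum>p\<in>(\<lambda>\<sigma>. l \<circ> \<sigma>) ` ?P. kron_power E (function_matrix \<phi>) i p * T p l)"
      using perm fin tuple_comp_permutes[OF l(1)]
      by (intro sum.mono_neutral_right) (auto simp del: PiE_iff)
    also have "\<dots> = (\<Sum>\<sigma>\<in>?P. kron_power E (function_matrix \<phi>) i (l \<circ> \<sigma>) * T (l \<circ> \<sigma>) l)"
      using comp_inj_tuple_eq_iff[OF l(2)] by (subst sum.reindex) (auto simp: inj_on_def)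
    also have "\<dots> = (\<Sum>\<sigma>\<in>?P. if j \<circ> \<sigma> = i then c \<sigma> else 0)"
      by (intro sum.cong refl) (auto simp: kron_power_map[OF E(1) i] rj c_def simp del: PiE_iff)
    finally show ?thesis .
  qed
  then show ?thesis by (rule that)
qed

section \<open>Moments of Haar distributed unitary matrices\<close>

lemma conj_transpose_mult: "conj_transpose (A ** B) = conj_transpose B ** conj_transpose A"
  by (simp add: conj_transpose_def matrix_matrix_mult_def vec_eq_iff mult.commute)

lemma conj_transpose_invol [simp]: "conj_transpose (conj_transpose A) = A"
  by (simp add: conj_transpose_def vec_eq_iff)

lemma conj_transpose_unitary: "U \<in> unitary_group \<Longrightarrow> conj_transpose U \<in> unitary_group"
  by (simp add: unitary_group_def)

lemma unitary_mult:
  fixes U V :: "complex ^ 'n ^ 'n"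
  assumes "U \<in> unitary_group" "V \<in> unitary_group"
  shows "U ** V \<in> unitary_group"
proof -
  have U: "conj_transpose U ** U = mat 1" "U ** conj_transpose U = mat 1"
    and V: "conj_transpose V ** V = mat 1" "V ** conj_transpose V = mat 1"
    using assms by (auto simp: unitary_group_def)
  have "conj_transpose (U ** V) ** (U ** V) = conj_transpose V ** (conj_transpose U ** U) ** V"
    and "(U ** V) ** conj_transpose (U ** V) = U ** (V ** conj_transpose V) ** conj_transpose U"
    by (simp_all only: conj_transpose_mult matrix_mul_assoc)
  then show ?thesis by (simp add: unitary_group_def U V)
qed

lemma unitary_entry_bound:
  fixes U :: "complex ^ 'n ^ 'n"
  assumes "U \<in> unitary_group"
  shows "cmod (U $ a $ b) \<le> 1"
proof -
  have "(\<Sum>k\<in>UNIV. cnj (U $ k $ b) * U $ k $ b) = (conj_transpose U ** U) $ b $ b"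
    by (simp add: conj_transpose_def matrix_matrix_mult_def)
  also have "\<dots> = 1" using assms by (simp add: unitary_group_def mat_def)
  finally have "complex_of_real (\<Sum>k\<in>UNIV. (cmod (U $ k $ b))\<^sup>2) = 1"
    by (simp only: of_real_sum complex_norm_square mult.commute)
  then have sum1: "(\<Sum>k\<in>UNIV. (cmod (U $ k $ b))\<^sup>2) = 1"
    by (simp only: of_real_eq_1_iff)
  have "(cmod (U $ a $ b))\<^sup>2 \<le> (\<Sum>k\<in>UNIV. (cmod (U $ k $ b))\<^sup>2)"
    by (rule member_le_sum) auto
  then show ?thesis unfolding sum1 by (simp add: power2_le_iff_abs_le abs_le_square_iff[symmetric] power_le_one_iff)
qed

lemma space_haar: "haar_measure \<mu> \<Longrightarrow> space \<mu> = unitary_group"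
  using sets_eq_imp_space_eq[of \<mu> "restrict_space borel unitary_group"]
  by (simp add: haar_measure_def space_restrict_space)

lemma finite_measure_haar: "haar_measure \<mu> \<Longrightarrow> finite_measure \<mu>"
  unfolding haar_measure_def by (auto intro!: finite_measureI)

lemma measure_haar_space: "haar_measure \<mu> \<Longrightarrow> measure \<mu> (space \<mu>) = 1"
  unfolding haar_measure_def by (simp add: measure_def)

lemma continuous_measurable_haar:
  fixes f :: "complex ^ 'n ^ 'n \<Rightarrow> 'b :: topological_space"
  assumes "haar_measure \<mu>" "continuous_on UNIV f"
  shows "f \<in> borel_measurable \<mu>"
proof -
  have "f \<in> borel_measurable (restrict_space borel unitary_group)"
    using assms(2) by (intro measurable_restrict_space1 borel_measurable_continuous_onI)
  moreover have "sets \<mu> = sets (restrict_space borel unitary_group)"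
    using assms(1) by (simp add: haar_measure_def)
  ultimately show ?thesis using measurable_cong_sets[OF _ refl] by blast
qed

text \<open>
  The preimage of a set under translation by \<open>g\<close> is its image under translation by the inverse of \<open>g\<close>, so invariance
  of the measure of images yields invariance of the image measure.
\<close>

lemma haar_left_translation:
  fixes g :: "complex ^ 'n ^ 'n"
  assumes \<mu>: "haar_measure \<mu>" and g: "g \<in> unitary_group"
  shows "(\<lambda>h. g ** h) \<in> measurable \<mu> \<mu>" "distr \<mu> \<mu> (\<lambda>h. g ** h) = \<mu>"
proof -
  have sets: "sets \<mu> = sets (restrict_space borel unitary_group)"
    using \<mu> by (simp add: haar_measure_def)
  have gg: "conj_transpose g ** (g ** h) = h" "g ** (conj_transpose g ** h) = h" for h
    using g by (simp_all add: matrix_mul_assoc unitary_group_def)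
  have "continuous_on UNIV (\<lambda>h. g ** h)"
    unfolding matrix_matrix_mult_def by (intro continuous_intros)
  then have "(\<lambda>h. g ** h) \<in> borel_measurable \<mu>"
    by (rule continuous_measurable_haar[OF \<mu>])
  then have "(\<lambda>h. g ** h) \<in> measurable \<mu> (restrict_space borel unitary_group)"
    using unitary_mult[OF g] by (intro measurable_restrict_space2) (auto simp: space_haar[OF \<mu>])
  then show meas: "(\<lambda>h. g ** h) \<in> measurable \<mu> \<mu>"
    using measurable_cong_sets[OF refl sets] by blast
  show "distr \<mu> \<mu> (\<lambda>h. g ** h) = \<mu>"
  proof (rule measure_eqI)
    fix A assume "A \<in> sets (distr \<mu> \<mu> (\<lambda>h. g ** h))"
    then have A: "A \<in> sets \<mu>" by simp
    have "A \<subseteq> unitary_group" using sets.sets_into_space[OF A] by (simp add: space_haar[OF \<mu>])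
    then have "(\<lambda>h. g ** h) -` A \<inter> space \<mu> = (\<lambda>h. conj_transpose g ** h) ` A"
      using unitary_mult[OF conj_transpose_unitary[OF g]] gg(1)[symmetric]
      by (auto simp: space_haar[OF \<mu>] gg(2))
    then show "emeasure (distr \<mu> \<mu> (\<lambda>h. g ** h)) A = emeasure \<mu> A"
      using \<mu> A conj_transpose_unitary[OF g] by (simp add: emeasure_distr[OF meas] haar_measure_def)
  qed simp
qed

lemma kron_power_conj_transpose: "kron_power E (conj_transpose A) i j = cnj (kron_power E A j i)"
  by (simp add: kron_power_def conj_transpose_def)

lemma kron_power_one:
  fixes i j :: "'a \<Rightarrow> 'n :: finite"
  assumes "finite E" "i \<in> tuples E" "j \<in> tuples E"
  shows "kron_power E (mat 1) i j = (if i = j then 1 else 0)"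
proof -
  have "mat 1 = (diagonal_matrix (\<lambda>_. 1) :: complex ^ 'n ^ 'n)"
    by (simp add: mat_def diagonal_matrix_def)
  then show ?thesis using kron_power_diagonal[OF assms, of "\<lambda>_. 1"] by simp
qed

lemma kron_power_permute_row:
  assumes "\<tau> permutes E"
  shows "kron_power E A (i \<circ> \<tau>) j = kron_power E A i (j \<circ> inv \<tau>)"
  unfolding kron_power_def
  by (subst prod.permute[OF assms, where g = "\<lambda>e. A $ i e $ (j \<circ> inv \<tau>) e"])
    (use assms in \<open>simp add: permutes_inverses\<close>)

definition moment where
  "moment \<mu> E i j i' j' = (\<integral>U. kron_power E U i j * cnj (kron_power E U i' j') \<partial>\<mu>)"

lemma integrable_moment:
  fixes \<mu> :: "(complex ^ 'n ^ 'n) measure"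
  assumes \<mu>: "haar_measure \<mu>"
  shows "integrable \<mu> (\<lambda>U. kron_power E U i j * cnj (kron_power E U i' j'))"
proof (rule finite_measure.integrable_const_bound[OF finite_measure_haar[OF \<mu>], where B = 1])
  show "(\<lambda>U. kron_power E U i j * cnj (kron_power E U i' j')) \<in> borel_measurable \<mu>"
    unfolding kron_power_def
    by (intro continuous_measurable_haar[OF \<mu>] continuous_intros)
  have "cmod (kron_power E U i j) \<le> 1" if "U \<in> unitary_group" for U :: "complex ^ 'n ^ 'n" and i j
    unfolding kron_power_def prod_norm[symmetric]
    by (intro prod_le_1) (auto intro: unitary_entry_bound[OF that])
  then show "AE U in \<mu>. norm (kron_power E U i j * cnj (kron_power E U i' j')) \<le> 1"
    by (intro AE_I2) (auto simp: space_haar[OF \<mu>] norm_mult intro!: mult_le_one)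
qed

lemma moment_left_invariant:
  fixes \<mu> :: "(complex ^ 'n ^ 'n) measure"
  assumes \<mu>: "haar_measure \<mu>" and E: "finite E" and g: "g \<in> unitary_group"
  shows "moment \<mu> E i j i' j' = (\<Sum>p\<in>tuples E. \<Sum>p'\<in>tuples E.
    kron_power E g i p * cnj (kron_power E g i' p') * moment \<mu> E p j p' j')"
proof -
  have "moment \<mu> E i j i' j' =
      (\<integral>U. kron_power E (g ** U) i j * cnj (kron_power E (g ** U) i' j') \<partial>\<mu>)"
    unfolding moment_def
    by (subst (1) haar_left_translation(2)[OF \<mu> g, symmetric], rule integral_distr)
      (use haar_left_translation(1)[OF \<mu> g] borel_measurable_integrable[OF integrable_moment[OF \<mu>]]
        in auto)
  also have "\<dots> = (\<integral>U. (\<Sum>p\<in>tuples E. \<Sum>p'\<in>tuples E. kron_power E g i p * cnj (kron_power E g i' p') *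
      (kron_power E U p j * cnj (kron_power E U p' j'))) \<partial>\<mu>)"
    unfolding kron_power_mult[OF E, symmetric] cnj_sum sum_product
    by (simp add: mult_ac)
  also have "\<dots> = (\<Sum>p\<in>tuples E. \<Sum>p'\<in>tuples E.
    kron_power E g i p * cnj (kron_power E g i' p') * moment \<mu> E p j p' j')"
    unfolding moment_def
    by (simp add: Bochner_Integration.integral_sum integrable_moment[OF \<mu>])
  finally show ?thesis .
qed

text \<open>
  For fixed column indices, the moments form the average of \<open>U\<^sup>\<otimes> B (U\<^sup>\<otimes>)\<^sup>*\<close> over \<open>U\<close>, where \<open>B\<close> is an
  elementary matrix. Left invariance says that conjugation by \<open>g\<^sup>\<otimes>\<close> does not change the average.
\<close>

lemma moment_commutes:
  fixes \<mu> :: "(complex ^ 'n ^ 'n) measure"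
  assumes \<mu>: "haar_measure \<mu>" and E: "finite E" and g: "g \<in> unitary_group"
  shows "commutes_power E (\<lambda>i i'. moment \<mu> E i j i' j') g"
  unfolding commutes_power_def
proof (intro ballI)
  fix i q :: "'a \<Rightarrow> 'n" assume q: "q \<in> tuples E"
  let ?S = "tuples E :: ('a \<Rightarrow> 'n) set" and ?K = "kron_power E g" and ?T = "\<lambda>i i'. moment \<mu> E i j i' j'"
  have unit: "(\<Sum>i'\<in>?S. cnj (?K i' p') * ?K i' q) = (if p' = q then 1 else 0)" if "p' \<in> ?S" for p'
  proof -
    have "(\<Sum>i'\<in>?S. cnj (?K i' p') * ?K i' q) = kron_power E (conj_transpose g ** g) p' q"
      by (simp add: kron_power_mult[OF E, symmetric] kron_power_conj_transpose)
    also have "\<dots> = (if p' = q then 1 else 0)"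
      using g kron_power_one[OF E that q] by (simp add: unitary_group_def)
    finally show ?thesis .
  qed
  have "(\<Sum>i'\<in>?S. ?T i i' * ?K i' q) =
      (\<Sum>i'\<in>?S. \<Sum>p\<in>?S. \<Sum>p'\<in>?S. ?K i p * ?T p p' * (cnj (?K i' p') * ?K i' q))"
    by (subst moment_left_invariant[OF \<mu> E g]) (simp add: sum_distrib_left sum_distrib_right mult_ac)
  also have "\<dots> = (\<Sum>p\<in>?S. \<Sum>p'\<in>?S. ?K i p * ?T p p' * (\<Sum>i'\<in>?S. cnj (?K i' p') * ?K i' q))"
    by (subst sum.swap, rule sum.cong[OF refl], subst sum.swap) (simp add: sum_distrib_left)
  also have "\<dots> = (\<Sum>p\<in>?S. \<Sum>p'\<in>?S. if p' = q then ?K i p * ?T p q else 0)"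
    by (intro sum.cong refl) (simp add: unit del: PiE_iff)
  also have "\<dots> = (\<Sum>p\<in>?S. ?K i p * ?T p q)"
    using q E by (simp del: PiE_iff)
  finally show "(\<Sum>p\<in>?S. ?T i p * ?K p q) = (\<Sum>p\<in>?S. ?K i p * ?T p q)" .
qed

text \<open>
  Permutation operators commute with the tensor powers of \<open>U\<close>, so tracing the averaged operator against
  one of them is the same as tracing the elementary matrix that is averaged.
\<close>

lemma moment_trace:
  fixes \<mu> :: "(complex ^ 'n ^ 'n) measure"
  assumes \<mu>: "haar_measure \<mu>" and E: "finite E" and j: "j \<in> tuples E" and j': "j' \<in> tuples E"
    and \<tau>: "\<tau> permutes E"
  shows "(\<Sum>i\<in>tuples E. moment \<mu> E (i \<circ> \<tau>) j i j') = (if j \<circ> inv \<tau> = j' then 1 else 0)"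
proof -
  have "(\<Sum>i\<in>tuples E. moment \<mu> E (i \<circ> \<tau>) j i j') =
      (\<integral>U. (\<Sum>i\<in>tuples E. kron_power E U (i \<circ> \<tau>) j * cnj (kron_power E U i j')) \<partial>\<mu>)"
    unfolding moment_def by (simp add: Bochner_Integration.integral_sum integrable_moment[OF \<mu>])
  also have "\<dots> = (\<integral>U. (if j \<circ> inv \<tau> = j' then 1 else 0) \<partial>\<mu>)"
  proof (rule Bochner_Integration.integral_cong[OF refl])
    fix U assume "U \<in> space \<mu>"
    then have U: "conj_transpose U ** U = mat 1" by (simp add: space_haar[OF \<mu>] unitary_group_def)
    have "(\<Sum>i\<in>tuples E. kron_power E U (i \<circ> \<tau>) j * cnj (kron_power E U i j')) =
        kron_power E (conj_transpose U ** U) j' (j \<circ> inv \<tau>)"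
      by (simp add: kron_power_mult[OF E, symmetric] kron_power_conj_transpose
          kron_power_permute_row[OF \<tau>] mult.commute)
    also have "\<dots> = (if j \<circ> inv \<tau> = j' then 1 else 0)"
      using kron_power_one[OF E j' tuple_comp_permutes[OF j permutes_inv[OF \<tau>]]] by (auto simp: U)
    finally show "(\<Sum>i\<in>tuples E. kron_power E U (i \<circ> \<tau>) j * cnj (kron_power E U i j')) =
        (if j \<circ> inv \<tau> = j' then 1 else 0)" .
  qed
  also have "\<dots> = (if j \<circ> inv \<tau> = j' then 1 else 0)"
    using measure_haar_space[OF \<mu>] by simp
  finally show ?thesis .
qed

text \<open>
  By \<open>commutant_of_unitary_power\<close> the moments are a combination of permutation operators, and by
  \<open>moment_trace\<close> the coefficients solve a linear system with the Gram matrix.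
\<close>

theorem weingarten_formula:
  fixes \<mu> :: "(complex ^ 'n ^ 'n) measure" and E :: "'a set"
  assumes \<mu>: "haar_measure \<mu>" and E: "finite E" "card E \<le> CARD('n)"
    and i: "i \<in> tuples E" and i': "i' \<in> tuples E" and j: "j \<in> tuples E" and j': "j' \<in> tuples E"
  shows "moment \<mu> E i j i' j' = (\<Sum>\<sigma> | \<sigma> permutes E. \<Sum>\<tau> | \<tau> permutes E.
    if i' \<circ> \<sigma> = i \<and> j \<circ> \<tau> = j' then weingarten CARD('n) E (\<sigma> \<circ> \<tau>) else 0)"
proof -
  let ?S = "tuples E :: ('a \<Rightarrow> 'n) set" and ?P = "{\<sigma>. \<sigma> permutes E}"
    and ?W = "weingarten CARD('n) E" and ?C = "cycle_element CARD('n) E"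
  obtain c where c: "\<And>i i'. i \<in> ?S \<Longrightarrow> i' \<in> ?S \<Longrightarrow>
      moment \<mu> E i j i' j' = (\<Sum>\<sigma>\<in>?P. if i' \<circ> \<sigma> = i then c \<sigma> else 0)"
    using commutant_of_unitary_power[where T = "\<lambda>i i'. moment \<mu> E i j i' j'",
        OF E moment_commutes[OF \<mu> E(1)]] by blast
  have "(\<Sum>\<sigma>\<in>?P. ?C (\<tau> \<circ> inv \<sigma>) * c \<sigma>) = (if j \<circ> inv \<tau> = j' then 1 else 0)"
    if \<tau>: "\<tau> permutes E" for \<tau>
  proof -
    have "(if j \<circ> inv \<tau> = j' then 1 else 0) = (\<Sum>i\<in>?S. moment \<mu> E (i \<circ> \<tau>) j i j')"
      by (simp add: moment_trace[OF \<mu> E(1) j j' \<tau>])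
    also have "\<dots> = (\<Sum>i\<in>?S. \<Sum>\<sigma>\<in>?P. if i \<circ> \<sigma> = i \<circ> \<tau> then c \<sigma> else 0)"
      by (intro sum.cong refl c tuple_comp_permutes \<tau>)
    also have "\<dots> = (\<Sum>\<sigma>\<in>?P. \<Sum>i\<in>?S. if i \<circ> \<tau> = i \<circ> \<sigma> then c \<sigma> else 0)"
      by (subst sum.swap) (intro sum.cong refl, auto)
    also have "\<dots> = (\<Sum>\<sigma>\<in>?P. ?C (\<tau> \<circ> inv \<sigma>) * c \<sigma>)"
    proof (rule sum.cong[OF refl])
      fix \<sigma> assume "\<sigma> \<in> ?P"
      then show "(\<Sum>i\<in>?S. if i \<circ> \<tau> = i \<circ> \<sigma> then c \<sigma> else 0) = ?C (\<tau> \<circ> inv \<sigma>) * c \<sigma>"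
        using E(1) \<tau> by (simp add: cycle_element_gram sum.If_cases Int_def)
    qed
    finally show ?thesis ..
  qed
  then have c_eq: "c \<sigma> = (\<Sum>\<tau>\<in>?P. ?W (\<sigma> \<circ> inv \<tau>) * (if j \<circ> inv \<tau> = j' then 1 else 0))"
    if "\<sigma> permutes E" for \<sigma>
    using that by (rule gram_system_solution[OF E])
  have "c \<sigma> = (\<Sum>\<tau>\<in>?P. if j \<circ> \<tau> = j' then ?W (\<sigma> \<circ> \<tau>) else 0)" if "\<sigma> permutes E" for \<sigma>
    unfolding c_eq[OF that]
    by (subst sum_permutations_inverse) (auto intro!: sum.cong simp: permutes_inv_inv)
  then show ?thesis
    unfolding c[OF i i'] by (intro sum.cong refl) auto
qed

section \<open>Expanding products of traces over the letter occurrences\<close>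

lemma sum_tuples_insert:
  fixes f :: "('a \<Rightarrow> 'n :: finite) \<Rightarrow> 'c :: comm_monoid_add"
  assumes "x \<notin> A"
  shows "(\<Sum>c\<in>tuples (insert x A). f c) = (\<Sum>c\<in>tuples A. \<Sum>y\<in>UNIV. f (c(x := y)))"
proof -
  have "(\<Sum>c\<in>tuples (insert x A). f c) = (\<Sum>z\<in>UNIV \<times> tuples A. f ((snd z)(x := fst z)))"
    unfolding PiE_insert_eq
    by (subst sum.reindex[OF inj_combinator[OF assms]]) (simp add: case_prod_beta o_def)
  also have "\<dots> = (\<Sum>y\<in>UNIV. \<Sum>c\<in>tuples A. f (c(x := y)))"
    by (simp add: sum.cartesian_product')
  also have "\<dots> = (\<Sum>c\<in>tuples A. \<Sum>y\<in>UNIV. f (c(x := y)))" by (rule sum.swap)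
  finally show ?thesis .
qed

lemma word_matrix_append:
  "word_matrix U V (w @ w') = word_matrix U V w ** word_matrix U V w'"
  by (induction w) (simp_all add: word_matrix_def matrix_mul_assoc[symmetric])

text \<open>
  The right end \<open>b\<close> of the path of indices is kept out of the tuple, because closing the path to a
  cycle, as the trace does, identifies it with the left end \<open>c 0\<close>.
\<close>

lemma word_matrix_entry:
  fixes U V :: "complex ^ 'n ^ 'n"
  assumes "length w = Suc l"
  shows "word_matrix U V w $ a $ b = (\<Sum>c\<in>tuples {..<Suc l}. if c 0 = a
    then (\<Prod>k<l. letter_matrix U V (w ! k) $ c k $ c (Suc k)) * letter_matrix U V (w ! l) $ c l $ b
    else 0)"
  using assms
proof (induction l arbitrary: w b)
  case 0
  then obtain x where w: "w = [x]" by (metis Suc_length_conv length_0_conv)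
  have "{..<Suc 0} = insert 0 {}" by auto
  then show ?case
    by (simp only: sum_tuples_insert[where A = "{}"] empty_iff not_False_eq_True)
      (simp add: w word_matrix_def)
next
  case (Suc l)
  define w' where "w' = take (Suc l) w"
  let ?L = "\<lambda>k. letter_matrix U V (w ! k)"
  have w: "w = w' @ [w ! Suc l]"
    using Suc.prems unfolding w'_def by (metis lessI take_Suc_conv_app_nth take_all_iff order_refl)
  have len: "length w' = Suc l" using Suc.prems by (simp add: w'_def)
  have last: "word_matrix U V [x] = letter_matrix U V x" for x by (simp add: word_matrix_def)
  have nth: "w' ! k = w ! k" if "k < Suc l" for k using that by (simp add: w'_def)
  have "word_matrix U V w $ a $ b = (\<Sum>y\<in>UNIV. word_matrix U V w' $ a $ y * ?L (Suc l) $ y $ b)"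
    by (subst w) (simp add: word_matrix_append last matrix_matrix_mult_def)
  also have "\<dots> = (\<Sum>y\<in>UNIV. \<Sum>c\<in>tuples {..<Suc l}. if c 0 = a
      then (\<Prod>k<l. ?L k $ c k $ c (Suc k)) * ?L l $ c l $ y * ?L (Suc l) $ y $ b else 0)"
    by (simp add: Suc.IH[OF len] sum_distrib_right nth if_distrib[where f = "\<lambda>z. z * _"] cong: if_cong)
  also have "\<dots> = (\<Sum>c\<in>tuples {..<Suc l}. \<Sum>y\<in>UNIV. if c 0 = a
      then (\<Prod>k<l. ?L k $ c k $ c (Suc k)) * ?L l $ c l $ y * ?L (Suc l) $ y $ b else 0)"
    by (rule sum.swap)
  also have "\<dots> = (\<Sum>c\<in>tuples {..<Suc l}. \<Sum>y\<in>UNIV. if (c(Suc l := y)) 0 = a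
      then (\<Prod>k<Suc l. ?L k $ (c(Suc l := y)) k $ (c(Suc l := y)) (Suc k)) *
        ?L (Suc l) $ (c(Suc l := y)) (Suc l) $ b else 0)"
    by (intro sum.cong refl) (simp add: mult.assoc)
  also have "\<dots> = (\<Sum>c\<in>tuples (insert (Suc l) {..<Suc l}). if c 0 = a
      then (\<Prod>k<Suc l. ?L k $ c k $ c (Suc k)) * ?L (Suc l) $ c (Suc l) $ b else 0)"
    by (rule sum_tuples_insert[symmetric]) simp
  finally show ?case by (simp only: lessThan_Suc[of "Suc l", symmetric])
qed

lemma trace_word_matrix:
  fixes U V :: "complex ^ 'n ^ 'n"
  assumes "w \<noteq> []"
  shows "trace (word_matrix U V w) = (\<Sum>c\<in>tuples {..<length w}.
    \<Prod>k<length w. letter_matrix U V (w ! k) $ c k $ c (Suc k mod length w))"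
proof -
  obtain l where l: "length w = Suc l" using assms by (cases w) auto
  let ?L = "\<lambda>k. letter_matrix U V (w ! k)"
  have "trace (word_matrix U V w) = (\<Sum>c\<in>tuples {..<Suc l}. \<Sum>a\<in>UNIV. if c 0 = a
      then (\<Prod>k<l. ?L k $ c k $ c (Suc k)) * ?L l $ c l $ a else 0)"
    unfolding trace_def word_matrix_entry[OF l] by (rule sum.swap)
  also have "\<dots> = (\<Sum>c\<in>tuples {..<Suc l}. (\<Prod>k<l. ?L k $ c k $ c (Suc k)) * ?L l $ c l $ c 0)"
    by simp
  also have "\<dots> = (\<Sum>c\<in>tuples {..<Suc l}. \<Prod>k<Suc l. ?L k $ c k $ c (Suc k mod Suc l))"
  proof (rule sum.cong[OF refl])
    fix c :: "nat \<Rightarrow> 'n"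
    have "(\<Prod>k<l. ?L k $ c k $ c (Suc k mod Suc l)) = (\<Prod>k<l. ?L k $ c k $ c (Suc k))"
      by (intro prod.cong refl) simp
    then show "(\<Prod>k<l. ?L k $ c k $ c (Suc k)) * ?L l $ c l $ c 0 =
        (\<Prod>k<Suc l. ?L k $ c k $ c (Suc k mod Suc l))"
      by simp
  qed
  finally show ?thesis by (simp add: l)
qed

lemma letter_matrix_inv: "letter_matrix U V (inv_letter x) = conj_transpose (letter_matrix U V x)"
  by (cases x) simp_all

lemma word_matrix_inv: "word_matrix U V (inv_word w) = conj_transpose (word_matrix U V w)"
proof (induction w)
  case Nil
  show ?case by (simp add: inv_word_def word_matrix_def conj_transpose_def mat_def vec_eq_iff)
next
  case (Cons x w)
  have "inv_word (x # w) = inv_word w @ [inv_letter x]" by (simp add: inv_word_def)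
  then show ?case
    using Cons by (simp add: word_matrix_append conj_transpose_mult)
      (simp add: word_matrix_def letter_matrix_inv conj_transpose_mult)
qed

lemma trace_conj_transpose: "trace (conj_transpose A) = cnj (trace A)"
  by (simp add: trace_def conj_transpose_def)

text \<open>
  Distributing the product over the sums amounts to choosing one index tuple for each word and each
  inverse word, which together are one tuple on all occurrences.
\<close>

lemma prod_of_sums_over_occs:
  fixes f :: "nat \<Rightarrow> bool \<Rightarrow> (nat \<Rightarrow> 'n :: finite) \<Rightarrow> complex"
  shows "(\<Prod>i<length ws. \<Prod>s\<in>UNIV. \<Sum>g\<in>tuples {..<length (ws ! i)}. f i s g) =
    (\<Sum>c\<in>tuples (occs ws). \<Prod>i<length ws. \<Prod>s\<in>UNIV. f i s (\<lambda>k\<in>{..<length (ws ! i)}. c (i, s, k)))"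
proof -
  let ?A = "{..<length ws} \<times> (UNIV :: bool set)" and ?B = "\<lambda>z. tuples {..<length (ws ! fst z)} :: (nat \<Rightarrow> 'n) set"
  define F :: "(nat \<times> bool \<Rightarrow> nat \<Rightarrow> 'n) \<Rightarrow> occ \<Rightarrow> 'n"
    where "F G = (\<lambda>(i, s, k)\<in>occs ws. G (i, s) k)" for G
  define H :: "(occ \<Rightarrow> 'n) \<Rightarrow> nat \<times> bool \<Rightarrow> nat \<Rightarrow> 'n"
    where "H c = (\<lambda>(i, s)\<in>?A. \<lambda>k\<in>{..<length (ws ! i)}. c (i, s, k))" for c
  have H_in: "H c \<in> PiE ?A ?B" for c by (auto simp: H_def split: if_splits)
  have "(\<Prod>i<length ws. \<Prod>s\<in>UNIV. \<Sum>g\<in>tuples {..<length (ws ! i)}. f i s g) =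
      (\<Prod>z\<in>?A. \<Sum>g\<in>?B z. f (fst z) (snd z) g)"
    by (simp add: prod.cartesian_product')
  also have "\<dots> = (\<Sum>G\<in>PiE ?A ?B. \<Prod>z\<in>?A. f (fst z) (snd z) (G z))"
    by (rule prod_sum_PiE) auto
  also have "\<dots> = (\<Sum>c\<in>tuples (occs ws). \<Prod>z\<in>?A. f (fst z) (snd z) (H c z))"
  proof (rule sum.reindex_bij_witness[where i = H and j = F])
    fix G assume G: "G \<in> PiE ?A ?B"
    show FG: "H (F G) = G"
    proof (rule PiE_ext[OF _ G])
      show "H (F G) \<in> PiE ?A ?B" by (rule H_in)
      fix z assume z: "z \<in> ?A"
      obtain i s where [simp]: "z = (i, s)" by (cases z)
      show "H (F G) z = G z"
      proof (rule PiE_ext)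
        show "H (F G) z \<in> ?B z" using H_in z by (rule PiE_mem)
        show "G z \<in> ?B z" using G z by (rule PiE_mem)
        fix k assume "k \<in> {..<length (ws ! fst z)}"
        then show "H (F G) z k = G z k" using z by (simp add: H_def F_def occs_def)
      qed
    qed
    show "F G \<in> tuples (occs ws)" unfolding F_def restrict_PiE_iff by blast
    show "(\<Prod>z\<in>?A. f (fst z) (snd z) (H (F G) z)) = (\<Prod>z\<in>?A. f (fst z) (snd z) (G z))"
      by (simp only: FG)
  next
    fix c :: "occ \<Rightarrow> 'n" assume c: "c \<in> tuples (occs ws)"
    show "F (H c) = c"
    proof (rule PiE_ext[OF _ c])
      show "F (H c) \<in> tuples (occs ws)" unfolding F_def restrict_PiE_iff by blast
      fix x assume "x \<in> occs ws"
      then show "F (H c) x = c x" by (cases x) (simp add: F_def H_def occs_def)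
    qed
    show "H c \<in> PiE ?A ?B" by (rule H_in)
  qed
  also have "\<dots> = (\<Sum>c\<in>tuples (occs ws). \<Prod>i<length ws. \<Prod>s\<in>UNIV.
      f i s (\<lambda>k\<in>{..<length (ws ! i)}. c (i, s, k)))"
    by (intro sum.cong refl) (simp add: prod.cartesian_product' H_def)
  finally show ?thesis .
qed

lemma prod_occs:
  "(\<Prod>i<length ws. \<Prod>s\<in>UNIV. \<Prod>k<length (ws ! i). h (i, s, k)) = (\<Prod>x\<in>occs ws. h x)"
proof -
  have "(\<Prod>i<length ws. \<Prod>s\<in>UNIV. \<Prod>k<length (ws ! i). h (i, s, k)) =
      (\<Prod>i<length ws. \<Prod>z\<in>UNIV \<times> {..<length (ws ! i)}. h (i, z))"
    by (simp add: prod.cartesian_product')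
  also have "\<dots> = (\<Prod>x\<in>Sigma {..<length ws} (\<lambda>i. UNIV \<times> {..<length (ws ! i)}). h x)"
    by (subst prod.Sigma) (auto intro!: prod.cong)
  also have "Sigma {..<length ws} (\<lambda>i. UNIV \<times> {..<length (ws ! i)}) = occs ws"
    by (auto simp: occs_def)
  finally show ?thesis .
qed

text \<open>
  The inverse word stands for the conjugate transpose of the matrix of the word, so its trace is the
  complex conjugate; the modulus squared thus accounts for both copies of the word in
  \<open>occs ws\<close>.
\<close>

lemma trace_product_expansion:
  fixes U V :: "complex ^ 'n ^ 'n"
  assumes ne: "\<forall>w\<in>set ws. w \<noteq> []"
  shows "complex_of_real (\<Prod>w\<leftarrow>ws. (cmod (trace (word_matrix U V w)))\<^sup>2) =
    (\<Sum>c\<in>tuples (occs ws). \<Prod>x\<in>occs ws. letter_matrix U V (letter_at ws x) $ c x $ c (next_occ ws x))"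
proof -
  define word where "word i s = (if s then inv_word (ws ! i) else ws ! i)" for i s
  have len: "length (word i s) = length (ws ! i)" for i s
    by (simp add: word_def inv_word_def)
  have next_less: "Suc k mod l < l" if "k < l" for k l :: nat
    using that by (intro mod_less_divisor) auto
  have "complex_of_real (\<Prod>w\<leftarrow>ws. (cmod (trace (word_matrix U V w)))\<^sup>2) =
      (\<Prod>i<length ws. trace (word_matrix U V (ws ! i)) * cnj (trace (word_matrix U V (ws ! i))))"
    by (simp add: prod.list_conv_set_nth lessThan_atLeast0 complex_norm_square del: of_real_power)
  also have "\<dots> = (\<Prod>i<length ws. \<Prod>s\<in>UNIV. trace (word_matrix U V (word i s)))"
    by (simp add: UNIV_bool word_def word_matrix_inv trace_conj_transpose mult.commute)
  also have "\<dots> = (\<Prod>i<length ws. \<Prod>s\<in>UNIV. \<Sum>g\<in>tuples {..<length (ws ! i)}. \<Prod>k<length (ws ! i).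
      letter_matrix U V (word i s ! k) $ g k $ g (Suc k mod length (ws ! i)))"
  proof (intro prod.cong refl)
    fix i s assume "i \<in> {..<length ws}"
    then have "word i s \<noteq> []" using ne len[of i s] by (metis length_0_conv lessThan_iff nth_mem)
    from trace_word_matrix[OF this, of U V] show "trace (word_matrix U V (word i s)) = (\<Sum>g\<in>tuples {..<length (ws ! i)}.
        \<Prod>k<length (ws ! i). letter_matrix U V (word i s ! k) $ g k $ g (Suc k mod length (ws ! i)))"
      by (simp only: len)
  qed
  also have "\<dots> = (\<Sum>c\<in>tuples (occs ws). \<Prod>i<length ws. \<Prod>s\<in>UNIV. \<Prod>k<length (ws ! i).
      letter_matrix U V (letter_at ws (i, s, k)) $ c (i, s, k) $ c (next_occ ws (i, s, k)))"
    unfolding prod_of_sums_over_occs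
    by (intro sum.cong prod.cong refl) (simp add: word_def next_less)
  also have "\<dots> = (\<Sum>c\<in>tuples (occs ws). \<Prod>x\<in>occs ws.
      letter_matrix U V (letter_at ws x) $ c x $ c (next_occ ws x))"
    by (simp only: prod_occs[where h = "\<lambda>x. letter_matrix U V (letter_at ws x) $ c x $ c (next_occ ws x)" for c])
  finally show ?thesis .
qed

lemma occs_by_letter:
  "occs ws = (occs_of ws GenA \<union> occs_of ws InvA) \<union> (occs_of ws GenB \<union> occs_of ws InvB)"
proof (intro set_eqI iffI)
  fix x assume "x \<in> occs ws"
  then show "x \<in> (occs_of ws GenA \<union> occs_of ws InvA) \<union> (occs_of ws GenB \<union> occs_of ws InvB)"
    by (cases "letter_at ws x") (auto simp: occs_of_def)
qed (auto simp: occs_of_def)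

lemma prod_occs_by_letter:
  "(\<Prod>x\<in>occs ws. h x) = (\<Prod>x\<in>occs_of ws GenA. h x) * (\<Prod>x\<in>occs_of ws InvA. h x) *
    ((\<Prod>x\<in>occs_of ws GenB. h x) * (\<Prod>x\<in>occs_of ws InvB. h x))"
  unfolding occs_by_letter by (subst prod.union_disjoint | (auto simp: occs_of_def; fail))+

lemma I_map_eq: "x \<in> occs_of ws a \<Longrightarrow> I_map ws x = next_occ ws (Psi ws x)"
  by (simp add: I_map_def occs_of_def)

text \<open>
  The joint contribution of the occurrences of a letter \<open>a\<close> and of its inverse to the
  expansion, with the occurrences of the inverse letter transported to those of \<open>a\<close> by \<open>\<Psi>\<close>. The
  conjugate entry that belongs to \<open>\<Psi> x\<close> has its row and column exchanged: its row is the colour of the successor of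
  \<open>\<Psi> x\<close>, which is \<open>I x\<close>.
\<close>

definition paired_entries ::
    "letter list list \<Rightarrow> letter \<Rightarrow> (occ \<Rightarrow> 'n) \<Rightarrow> complex ^ 'n ^ 'n \<Rightarrow> complex" where
  "paired_entries ws a c M =
     kron_power (occs_of ws a) M c (c \<circ> next_occ ws) *
     cnj (kron_power (occs_of ws a) M (c \<circ> I_map ws) (c \<circ> Psi ws))"

lemma prod_letter_and_inverse:
  assumes "\<And>x. x \<in> occs_of ws a \<Longrightarrow> L x = M" "\<And>x. x \<in> occs_of ws (inv_letter a) \<Longrightarrow> L x = conj_transpose M"
  shows "(\<Prod>x\<in>occs_of ws a. L x $ c x $ c (next_occ ws x)) *
    (\<Prod>x\<in>occs_of ws (inv_letter a). L x $ c x $ c (next_occ ws x)) = paired_entries ws a c M"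
proof -
  have "(\<Prod>x\<in>occs_of ws (inv_letter a). L x $ c x $ c (next_occ ws x)) =
      (\<Prod>x\<in>occs_of ws (inv_letter a). cnj (M $ c (next_occ ws x) $ c x))"
    by (intro prod.cong refl) (simp add: assms(2) conj_transpose_def)
  also have "\<dots> = (\<Prod>x\<in>occs_of ws a. cnj (M $ c (next_occ ws (Psi ws x)) $ c (Psi ws x)))"
    by (rule prod.reindex_bij_betw[OF bij_betw_Psi, symmetric])
  finally show ?thesis
    by (simp add: paired_entries_def kron_power_def assms(1) I_map_eq)
qed

lemma trace_product_paired:
  fixes U V :: "complex ^ 'n ^ 'n"
  assumes ne: "\<forall>w\<in>set ws. w \<noteq> []"
  shows "complex_of_real (\<Prod>w\<leftarrow>ws. (cmod (trace (word_matrix U V w)))\<^sup>2) =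
    (\<Sum>c\<in>tuples (occs ws). paired_entries ws GenA c U * paired_entries ws GenB c V)"
proof -
  let ?L = "\<lambda>x. letter_matrix U V (letter_at ws x)"
  have A: "(\<Prod>x\<in>occs_of ws GenA. ?L x $ c x $ c (next_occ ws x)) *
      (\<Prod>x\<in>occs_of ws InvA. ?L x $ c x $ c (next_occ ws x)) = paired_entries ws GenA c U" for c
    using prod_letter_and_inverse[of ws GenA ?L U c] by (simp add: occs_of_def)
  have B: "(\<Prod>x\<in>occs_of ws GenB. ?L x $ c x $ c (next_occ ws x)) *
      (\<Prod>x\<in>occs_of ws InvB. ?L x $ c x $ c (next_occ ws x)) = paired_entries ws GenB c V" for c
    using prod_letter_and_inverse[of ws GenB ?L V c] by (simp add: occs_of_def)
  show ?thesis
    unfolding trace_product_expansion[OF ne] prod_occs_by_letter A B ..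
qed


section \<open>Integrating the expansion\<close>

lemma integrable_paired_entries: "haar_measure \<mu> \<Longrightarrow> integrable \<mu> (paired_entries ws a c)"
  using integrable_moment unfolding paired_entries_def by blast

lemma integral_trace_product:
  fixes \<mu> :: "(complex ^ 'n ^ 'n) measure"
  assumes \<mu>: "haar_measure \<mu>" and ne: "\<forall>w\<in>set ws. w \<noteq> []"
  shows "complex_of_real (\<integral>U. (\<integral>V. (\<Prod>w\<leftarrow>ws. (cmod (trace (word_matrix U V w)))\<^sup>2) \<partial>\<mu>) \<partial>\<mu>) =
    (\<Sum>c\<in>tuples (occs ws). (\<integral>U. paired_entries ws GenA c U \<partial>\<mu>) * (\<integral>V. paired_entries ws GenB c V \<partial>\<mu>))"
proof -
  note int = integrable_paired_entries[OF \<mu>]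
  have "complex_of_real (\<integral>U. (\<integral>V. (\<Prod>w\<leftarrow>ws. (cmod (trace (word_matrix U V w)))\<^sup>2) \<partial>\<mu>) \<partial>\<mu>) =
      (\<integral>U. (\<integral>V. complex_of_real (\<Prod>w\<leftarrow>ws. (cmod (trace (word_matrix U V w)))\<^sup>2) \<partial>\<mu>) \<partial>\<mu>)"
    by (simp only: integral_complex_of_real)
  also have "\<dots> = (\<integral>U. (\<Sum>c\<in>tuples (occs ws).
      paired_entries ws GenA c U * (\<integral>V. paired_entries ws GenB c V \<partial>\<mu>)) \<partial>\<mu>)"
    unfolding trace_product_paired[OF ne]
    by (simp add: Bochner_Integration.integral_sum int)
  also have "\<dots> = (\<Sum>c\<in>tuples (occs ws).
      (\<integral>U. paired_entries ws GenA c U \<partial>\<mu>) * (\<integral>V. paired_entries ws GenB c V \<partial>\<mu>))"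
    by (simp add: Bochner_Integration.integral_sum int)
  finally show ?thesis .
qed

text \<open>
  The moments do not see the values of index functions outside \<open>E\<close>; this version avoids the
  restriction of such functions to \<open>E\<close>.
\<close>

lemma weingarten_formula_pointwise:
  fixes \<mu> :: "(complex ^ 'n ^ 'n) measure" and E :: "'a set"
  assumes \<mu>: "haar_measure \<mu>" and E: "finite E" "card E \<le> CARD('n)"
  shows "moment \<mu> E i j i' j' = (\<Sum>\<sigma> | \<sigma> permutes E. \<Sum>\<tau> | \<tau> permutes E.
    if (\<forall>e\<in>E. i' (\<sigma> e) = i e) \<and> (\<forall>e\<in>E. j (\<tau> e) = j' e) then weingarten CARD('n) E (\<sigma> \<circ> \<tau>) else 0)"
proof -
  let ?r = "\<lambda>i. restrict i E"
  have eq: "?r i \<circ> \<sigma> = ?r i' \<longleftrightarrow> (\<forall>e\<in>E. i (\<sigma> e) = i' e)" if "\<sigma> permutes E"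
    for i i' :: "'a \<Rightarrow> 'n" and \<sigma>
  proof
    assume eq: "?r i \<circ> \<sigma> = ?r i'"
    show "\<forall>e\<in>E. i (\<sigma> e) = i' e"
    proof
      fix e assume "e \<in> E"
      then show "i (\<sigma> e) = i' e"
        using fun_cong[OF eq, of e] that by (simp add: permutes_in_image)
    qed
  next
    assume "\<forall>e\<in>E. i (\<sigma> e) = i' e"
    then show "?r i \<circ> \<sigma> = ?r i'"
      using that by (auto simp: fun_eq_iff permutes_in_image)
  qed
  have "moment \<mu> E i j i' j' = moment \<mu> E (?r i) (?r j) (?r i') (?r j')"
    by (simp add: moment_def kron_power_def)
  also have "\<dots> = (\<Sum>\<sigma> | \<sigma> permutes E. \<Sum>\<tau> | \<tau> permutes E.
      if ?r i' \<circ> \<sigma> = ?r i \<and> ?r j \<circ> \<tau> = ?r j' then weingarten CARD('n) E (\<sigma> \<circ> \<tau>) else 0)"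
    by (rule weingarten_formula[OF \<mu> E]) simp_all
  also have "\<dots> = (\<Sum>\<sigma> | \<sigma> permutes E. \<Sum>\<tau> | \<tau> permutes E.
    if (\<forall>e\<in>E. i' (\<sigma> e) = i e) \<and> (\<forall>e\<in>E. j (\<tau> e) = j' e) then weingarten CARD('n) E (\<sigma> \<circ> \<tau>) else 0)"
    by (intro sum.cong refl) (simp add: eq)
  finally show ?thesis .
qed

lemma Psi_conjugate_permutes:
  assumes "\<tau> permutes occs_of ws a"
  shows "(Psi ws \<circ> \<tau> \<circ> Psi ws) permutes occs_of ws (inv_letter a)"
  using twisted_permutes[OF permutes_id, where c = "inv_letter a" and \<theta> = \<tau> and ws = ws] assms by (simp add: inv_Psi)

definition fixed_by_I :: "letter list list \<Rightarrow> letter \<Rightarrow> (occ \<Rightarrow> occ) \<Rightarrow> (occ \<Rightarrow> 'n) \<Rightarrow> bool" where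
  "fixed_by_I ws a \<sigma> c \<longleftrightarrow> (\<forall>x\<in>occs_of ws a. c (I_map ws (\<sigma> x)) = c x)"

text \<open>
  In the Weingarten formula the rows give the condition \<open>c (I (\<sigma> x)) = c x\<close> and the columns give
  \<open>c (next (\<tau> x)) = c (\<Psi> x)\<close>. With \<open>\<theta> = \<Psi> \<circ> \<tau> \<circ> \<Psi>\<close> and \<open>y = \<Psi> x\<close> the latter becomes \<open>c (I (\<theta> y)) = c y\<close>,
  and the weight of \<open>\<sigma> \<circ> \<tau>\<close> becomes the one that occurs in \<open>\<Phi>\<close>.
\<close>

lemma integral_paired_entries:
  fixes \<mu> :: "(complex ^ 'n ^ 'n) measure"
  assumes \<mu>: "haar_measure \<mu>" and card: "card (occs_of ws a) \<le> CARD('n)"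
  shows "(\<integral>U. paired_entries ws a c U \<partial>\<mu>) =
    (\<Sum>\<sigma> | \<sigma> permutes occs_of ws a. \<Sum>\<theta> | \<theta> permutes occs_of ws (inv_letter a).
      if fixed_by_I ws a \<sigma> c \<and> fixed_by_I ws (inv_letter a) \<theta> c
      then weingarten CARD('n) (occs_of ws a) (\<sigma> \<circ> inv (Psi ws) \<circ> \<theta> \<circ> Psi ws) else 0)"
proof -
  let ?A = "occs_of ws a" and ?B = "occs_of ws (inv_letter a)" and ?W = "weingarten CARD('n) (occs_of ws a)"
    and ?\<Psi> = "Psi ws"
  have fold: "(\<forall>x\<in>?A. (c \<circ> I_map ws) (\<sigma> x) = c x) \<longleftrightarrow> fixed_by_I ws a \<sigma> c" for \<sigma>
    by (simp add: fixed_by_I_def)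
  have cond: "(\<forall>x\<in>?A. (c \<circ> next_occ ws) (\<tau> x) = (c \<circ> ?\<Psi>) x) \<longleftrightarrow>
      fixed_by_I ws (inv_letter a) (?\<Psi> \<circ> \<tau> \<circ> ?\<Psi>) c" if \<tau>: "\<tau> permutes ?A" for \<tau>
  proof -
    have "I_map ws ((?\<Psi> \<circ> \<tau> \<circ> ?\<Psi>) (?\<Psi> x)) = next_occ ws (\<tau> x)" if "x \<in> ?A" for x
      using that \<tau> Psi_occs_of[of "\<tau> x" ws a] by (simp add: I_map_eq permutes_in_image)
    moreover have "?B = ?\<Psi> ` ?A" using bij_betw_Psi[of ws a] by (simp add: bij_betw_def)
    ultimately show ?thesis by (simp add: fixed_by_I_def)
  qed
  have "(\<integral>U. paired_entries ws a c U \<partial>\<mu>) =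
      moment \<mu> ?A c (c \<circ> next_occ ws) (c \<circ> I_map ws) (c \<circ> ?\<Psi>)"
    by (simp add: moment_def paired_entries_def)
  also have "\<dots> = (\<Sum>\<sigma> | \<sigma> permutes ?A. \<Sum>\<tau> | \<tau> permutes ?A.
      if fixed_by_I ws a \<sigma> c \<and> fixed_by_I ws (inv_letter a) (?\<Psi> \<circ> \<tau> \<circ> ?\<Psi>) c then ?W (\<sigma> \<circ> \<tau>) else 0)"
    unfolding weingarten_formula_pointwise[OF \<mu> finite_occs_of card]
    by (intro sum.cong refl) (simp only: mem_Collect_eq fold cond)
  also have "\<dots> = (\<Sum>\<sigma> | \<sigma> permutes ?A. \<Sum>\<theta> | \<theta> permutes ?B.
      if fixed_by_I ws a \<sigma> c \<and> fixed_by_I ws (inv_letter a) \<theta> c then ?W (\<sigma> \<circ> inv ?\<Psi> \<circ> \<theta> \<circ> ?\<Psi>) else 0)"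
  proof (rule sum.cong[OF refl])
    fix \<sigma>
    show "(\<Sum>\<tau> | \<tau> permutes ?A. if fixed_by_I ws a \<sigma> c \<and>
          fixed_by_I ws (inv_letter a) (?\<Psi> \<circ> \<tau> \<circ> ?\<Psi>) c then ?W (\<sigma> \<circ> \<tau>) else 0) =
        (\<Sum>\<theta> | \<theta> permutes ?B. if fixed_by_I ws a \<sigma> c \<and> fixed_by_I ws (inv_letter a) \<theta> c
          then ?W (\<sigma> \<circ> inv ?\<Psi> \<circ> \<theta> \<circ> ?\<Psi>) else 0)"
    proof (rule sum.reindex_bij_witness[where i = "\<lambda>\<theta>. ?\<Psi> \<circ> \<theta> \<circ> ?\<Psi>" and j = "\<lambda>\<tau>. ?\<Psi> \<circ> \<tau> \<circ> ?\<Psi>"])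
      fix \<tau> assume "\<tau> \<in> {\<tau>. \<tau> permutes ?A}"
      then show "?\<Psi> \<circ> \<tau> \<circ> ?\<Psi> \<in> {\<theta>. \<theta> permutes ?B}" by (simp add: Psi_conjugate_permutes)
      have "\<sigma> \<circ> inv ?\<Psi> \<circ> (?\<Psi> \<circ> \<tau> \<circ> ?\<Psi>) \<circ> ?\<Psi> = \<sigma> \<circ> \<tau>"
        by (simp add: fun_eq_iff inv_Psi)
      then show "(if fixed_by_I ws a \<sigma> c \<and> fixed_by_I ws (inv_letter a) (?\<Psi> \<circ> \<tau> \<circ> ?\<Psi>) c
          then ?W (\<sigma> \<circ> inv ?\<Psi> \<circ> (?\<Psi> \<circ> \<tau> \<circ> ?\<Psi>) \<circ> ?\<Psi>) else 0) =
        (if fixed_by_I ws a \<sigma> c \<and> fixed_by_I ws (inv_letter a) (?\<Psi> \<circ> \<tau> \<circ> ?\<Psi>) c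
          then ?W (\<sigma> \<circ> \<tau>) else 0)" by simp
    next
      fix \<theta> assume "\<theta> \<in> {\<theta>. \<theta> permutes ?B}"
      then show "?\<Psi> \<circ> \<theta> \<circ> ?\<Psi> \<in> {\<tau>. \<tau> permutes ?A}"
        using Psi_conjugate_permutes[of \<theta> ws "inv_letter a"] by simp
    qed (simp_all add: fun_eq_iff)
  qed
  finally show ?thesis .
qed

lemma glue_permutes:
  assumes q: "q \<in> perms4 ws"
  shows "glue ws q permutes occs ws"
proof -
  obtain \<sigma>u \<theta>u \<sigma>v \<theta>v where q_eq: "q = (\<sigma>u, \<theta>u, \<sigma>v, \<theta>v)" by (cases q) auto
  define p where "p a = (case a of GenA \<Rightarrow> \<sigma>u | InvA \<Rightarrow> \<theta>u | GenB \<Rightarrow> \<sigma>v | InvB \<Rightarrow> \<theta>v)" for a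
  have p: "p a permutes occs_of ws a" for a
    using q by (cases a) (auto simp: q_eq perms4_def p_def)
  have glue: "glue ws q x = p (letter_at ws x) x" if "x \<in> occs ws" for x
    using that by (simp add: q_eq p_def split: letter.split)
  have in_class: "glue ws q x \<in> occs_of ws (letter_at ws x)" if "x \<in> occs ws" for x
    using that p by (simp add: glue permutes_in_image) (simp add: occs_of_def)
  have "inj_on (glue ws q) (occs ws)"
  proof (rule inj_onI)
    fix x y assume xy: "x \<in> occs ws" "y \<in> occs ws" "glue ws q x = glue ws q y"
    then have "letter_at ws x = letter_at ws y"
      using in_class[of x] in_class[of y] by (simp add: occs_of_def)
    then show "x = y"
      using xy glue permutes_inj[OF p] by (metis injD)
  qed
  moreover have "glue ws q ` occs ws \<subseteq> occs ws"
    using in_class by (auto simp: occs_of_def)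
  ultimately have "bij_betw (glue ws q) (occs ws) (occs ws)"
    by (simp add: bij_betw_def endo_inj_surj)
  then show ?thesis
    by (rule bij_imp_permutes) (simp add: q_eq)
qed

lemma fixed_by_I_glue:
  assumes c: "c \<in> tuples (occs ws)"
  shows "c \<circ> (I_map ws \<circ> glue ws (\<sigma>u, \<theta>u, \<sigma>v, \<theta>v)) = c \<longleftrightarrow>
    fixed_by_I ws GenA \<sigma>u c \<and> fixed_by_I ws InvA \<theta>u c \<and> fixed_by_I ws GenB \<sigma>v c \<and> fixed_by_I ws InvB \<theta>v c"
    (is "?lhs \<longleftrightarrow> ?rhs")
proof -
  let ?g = "glue ws (\<sigma>u, \<theta>u, \<sigma>v, \<theta>v)"
  have "?lhs \<longleftrightarrow> (\<forall>x\<in>occs ws. c (I_map ws (?g x)) = c x)"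
  proof
    assume *: "\<forall>x\<in>occs ws. c (I_map ws (?g x)) = c x"
    show ?lhs
    proof
      fix x show "(c \<circ> (I_map ws \<circ> ?g)) x = c x"
        using * by (cases "x \<in> occs ws") (auto simp: I_map_def)
    qed
  next
    assume eq: ?lhs
    show "\<forall>x\<in>occs ws. c (I_map ws (?g x)) = c x"
      using fun_cong[OF eq] by (simp only: o_apply) simp
  qed
  also have "\<dots> \<longleftrightarrow> (\<forall>x\<in>occs_of ws GenA. c (I_map ws (?g x)) = c x) \<and>
      (\<forall>x\<in>occs_of ws InvA. c (I_map ws (?g x)) = c x) \<and>
      (\<forall>x\<in>occs_of ws GenB. c (I_map ws (?g x)) = c x) \<and>
      (\<forall>x\<in>occs_of ws InvB. c (I_map ws (?g x)) = c x)"
    unfolding occs_by_letter ball_Un by (simp only: conj_assoc)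
  also have "\<dots> \<longleftrightarrow> ?rhs"
    unfolding fixed_by_I_def by (intro conj_cong ball_cong refl) (simp_all add: occs_of_def)
  finally show ?thesis .
qed

text \<open>
  After the integration, the four conditions on the permutations say together that \<open>c\<close> is fixed by
  \<open>I_map ws \<circ> glue ws q\<close>. Exchanging the sums over \<open>c\<close> and \<open>q\<close> leaves the number of such
  colourings, which is the coefficient of \<open>q\<close> in \<open>R\<close>.
\<close>

theorem integral_eq_Phi_R:
  fixes \<mu> :: "(complex ^ 'n ^ 'n) measure"
  assumes \<mu>: "haar_measure \<mu>" and ne: "\<forall>w\<in>set ws. w \<noteq> []"
    and card: "card (occs_of ws GenA) \<le> CARD('n)" "card (occs_of ws GenB) \<le> CARD('n)"
  shows "complex_of_real (\<integral>U. (\<integral>V. (\<Prod>w\<leftarrow>ws. (cmod (trace (word_matrix U V w)))\<^sup>2) \<partial>\<mu>) \<partial>\<mu>) =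
    Phi CARD('n) ws (R_element CARD('n) ws)"
proof -
  let ?S = "tuples (occs ws) :: (occ \<Rightarrow> 'n) set" and ?g = "\<lambda>q. I_map ws \<circ> glue ws q"
  let ?P = "\<lambda>a. {\<sigma>. \<sigma> permutes occs_of ws a}" and ?\<Phi> = "Phi_basis CARD('n) ws"
  have count: "(\<Sum>c\<in>?S. if c \<circ> ?g q = c then ?\<Phi> q else 0) = R_element CARD('n) ws q * ?\<Phi> q"
    if q: "q \<in> perms4 ws" for q
  proof -
    have "?g q permutes occs ws" using glue_permutes[OF q] I_map_permutes by (rule permutes_compose)
    from card_tuples_fixed[OF finite_occs this, where 'n = 'n]
    show ?thesis by (simp add: R_element_def q sum.If_cases Int_def)
  qed
  have "(\<integral>U. paired_entries ws GenA c U \<partial>\<mu>) * (\<integral>V. paired_entries ws GenB c V \<partial>\<mu>) =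
      (\<Sum>q\<in>perms4 ws. if c \<circ> ?g q = c then ?\<Phi> q else 0)" if c: "c \<in> ?S" for c
  proof -
    have "(\<Sum>q\<in>perms4 ws. if c \<circ> ?g q = c then ?\<Phi> q else 0) =
        (\<Sum>\<sigma>u\<in>?P GenA. \<Sum>\<theta>u\<in>?P InvA. \<Sum>\<sigma>v\<in>?P GenB. \<Sum>\<theta>v\<in>?P InvB.
          (if fixed_by_I ws GenA \<sigma>u c \<and> fixed_by_I ws InvA \<theta>u c then
             weingarten CARD('n) (occs_of ws GenA) (\<sigma>u \<circ> inv (Psi ws) \<circ> \<theta>u \<circ> Psi ws) else 0) *
          (if fixed_by_I ws GenB \<sigma>v c \<and> fixed_by_I ws InvB \<theta>v c then
             weingarten CARD('n) (occs_of ws GenB) (\<sigma>v \<circ> inv (Psi ws) \<circ> \<theta>v \<circ> Psi ws) else 0))"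
      unfolding perms4_def sum.cartesian_product'
      by (intro sum.cong refl) (simp add: fixed_by_I_glue[OF c] del: glue.simps)
    also have "\<dots> = (\<integral>U. paired_entries ws GenA c U \<partial>\<mu>) * (\<integral>V. paired_entries ws GenB c V \<partial>\<mu>)"
      unfolding integral_paired_entries[OF \<mu> card(1)] integral_paired_entries[OF \<mu> card(2)]
        inv_letter.simps
      by (simp only: sum_distrib_right, simp only: sum_distrib_left)
    finally show ?thesis ..
  qed
  then have "(\<Sum>c\<in>?S. (\<integral>U. paired_entries ws GenA c U \<partial>\<mu>) * (\<integral>V. paired_entries ws GenB c V \<partial>\<mu>)) =
      (\<Sum>c\<in>?S. \<Sum>q\<in>perms4 ws. if c \<circ> ?g q = c then ?\<Phi> q else 0)"
    by (rule sum.cong[OF refl])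
  also have "\<dots> = (\<Sum>q\<in>perms4 ws. \<Sum>c\<in>?S. if c \<circ> ?g q = c then ?\<Phi> q else 0)"
    by (rule sum.swap)
  also have "\<dots> = Phi CARD('n) ws (R_element CARD('n) ws)"
    unfolding Phi_def by (rule sum.cong[OF refl]) (rule count)
  finally show ?thesis unfolding integral_trace_product[OF \<mu> ne] .
qed

section \<open>Relabelling\<close>

text \<open>
  An involution that exchanges the two sides pairs the points on one side of an invariant set with
  the points on the other side.
\<close>

lemma card_involution_half:
  assumes Z: "finite Z" and k: "\<And>z. z \<in> Z \<Longrightarrow> k z \<in> Z \<and> k (k z) = z \<and> s (k z) = (\<not> s z)"
  shows "card {z \<in> Z. l z = c \<and> l (k z) = c} = 2 * card {z \<in> Z. l z = c \<and> l (k z) = c \<and> s z}"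
proof -
  let ?P = "{z \<in> Z. l z = c \<and> l (k z) = c \<and> s z}" and ?N = "{z \<in> Z. l z = c \<and> l (k z) = c \<and> \<not> s z}"
  have "bij_betw k ?P ?N"
    by (rule bij_betw_byWitness[where f' = k]) (use k in auto)
  then have "card ?P = card ?N" by (rule bij_betw_same_card)
  moreover have "{z \<in> Z. l z = c \<and> l (k z) = c} = ?P \<union> ?N" by auto
  moreover have "card (?P \<union> ?N) = card ?P + card ?N" using Z by (intro card_Un_disjoint) auto
  ultimately show ?thesis by simp
qed

text \<open>
  Both sets are reconstructed from a fundamental domain of the involution, and a bijection between the
  fundamental domains extends uniquely to an equivariant bijection. Between
  two different labels the domain takes all points with the smaller label; inside one label
  the side breaks the tie. The number of points of the domain with prescribed labels is then determined by the
  numbers in the hypothesis.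
\<close>

lemma labelled_involutions_isomorphic:
  fixes X :: "'a set" and Y :: "'b set" and lab :: "'a \<Rightarrow> nat" and lab' :: "'b \<Rightarrow> nat"
  assumes fin: "finite X" "finite Y"
    and I: "\<And>x. x \<in> X \<Longrightarrow> I x \<in> X \<and> I (I x) = x \<and> side (I x) = (\<not> side x)"
    and J: "\<And>y. y \<in> Y \<Longrightarrow> J y \<in> Y \<and> J (J y) = y \<and> side' (J y) = (\<not> side' y)"
    and card: "\<And>c d. card {x \<in> X. lab x = c \<and> lab (I x) = d} = card {y \<in> Y. lab' y = c \<and> lab' (J y) = d}"
  obtains f where "bij_betw f X Y" "\<And>x. x \<in> X \<Longrightarrow> lab' (f x) = lab x"
    "\<And>x. x \<in> X \<Longrightarrow> f (I x) = J (f x)"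
proof -
  \<comment> \<open>\<open>D\<close> and \<open>D'\<close> contain exactly one point of each orbit of the involution.\<close>
  define D where "D = {x \<in> X. lab x < lab (I x) \<or> lab x = lab (I x) \<and> side x}"
  define D' where "D' = {y \<in> Y. lab' y < lab' (J y) \<or> lab' y = lab' (J y) \<and> side' y}"
  define K where "K c d = {x \<in> D. lab x = c \<and> lab (I x) = d}" for c d
  define K' where "K' c d = {y \<in> D'. lab' y = c \<and> lab' (J y) = d}" for c d
  have D_I: "I x \<in> D \<longleftrightarrow> x \<notin> D" if "x \<in> X" for x
    using I[OF that] that by (auto simp: D_def)
  have D_J: "J y \<in> D' \<longleftrightarrow> y \<notin> D'" if "y \<in> Y" for y
    using J[OF that] that by (auto simp: D'_def)
  have "card (K c d) = card (K' c d)" for c d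
  proof (cases c d rule: linorder_cases)
    case less
    then have "K c d = {x \<in> X. lab x = c \<and> lab (I x) = d}"
      "K' c d = {y \<in> Y. lab' y = c \<and> lab' (J y) = d}"
      by (auto simp: K_def K'_def D_def D'_def)
    then show ?thesis by (simp add: card)
  next
    case equal
    then have K: "K c d = {x \<in> X. lab x = c \<and> lab (I x) = c \<and> side x}"
      "K' c d = {y \<in> Y. lab' y = c \<and> lab' (J y) = c \<and> side' y}"
      by (auto simp: K_def K'_def D_def D'_def)
    have "2 * card (K c d) = 2 * card (K' c d)"
      using card_involution_half[OF fin(1) I, of lab c] card_involution_half[OF fin(2) J, of lab' c] card[of c c] unfolding K by simp
    then show ?thesis by simp
  next
    case greater
    then have "K c d = {}" "K' c d = {}"
      by (auto simp: K_def K'_def D_def D'_def)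
    then show ?thesis by simp
  qed
  moreover have "finite (K c d)" "finite (K' c d)" for c d
    using fin by (auto simp: K_def K'_def D_def D'_def)
  ultimately have "\<exists>g. bij_betw g (K c d) (K' c d)" for c d
    by (simp add: bij_betw_iff_card)
  then obtain g where g: "bij_betw (g c d) (K c d) (K' c d)" for c d by metis
  define h where "h x = g (lab x) (lab (I x)) x" for x
  have h: "h x \<in> D'" "lab' (h x) = lab x" "lab' (J (h x)) = lab (I x)" if "x \<in> D" for x
  proof -
    have "x \<in> K (lab x) (lab (I x))" using that by (simp add: K_def)
    then have "h x \<in> K' (lab x) (lab (I x))" using bij_betwE[OF g] by (simp add: h_def)
    then show "h x \<in> D'" "lab' (h x) = lab x" "lab' (J (h x)) = lab (I x)" by (auto simp: K'_def)
  qed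
  have h_inj: "x = y" if "x \<in> D" "y \<in> D" "h x = h y" for x y
  proof -
    have lab: "lab x = lab y" "lab (I x) = lab (I y)" using h that by metis+
    then have "x \<in> K (lab x) (lab (I x))" "y \<in> K (lab x) (lab (I x))"
      using that by (simp_all add: K_def)
    then show "x = y"
      using that(3) lab bij_betw_imp_inj_on[OF g[of "lab x" "lab (I x)"]] by (simp add: h_def inj_on_def)
  qed
  have h_surj: "\<exists>x\<in>D. h x = y" if "y \<in> D'" for y
  proof -
    have "y \<in> K' (lab' y) (lab' (J y))" using that by (simp add: K'_def)
    then obtain x where "x \<in> K (lab' y) (lab' (J y))" "g (lab' y) (lab' (J y)) x = y"
      using bij_betw_imp_surj_on[OF g[of "lab' y" "lab' (J y)"]] by (metis imageE)
    then have "x \<in> D" "h x = y" by (simp_all add: K_def h_def)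
    then show ?thesis by blast
  qed
  have DX: "x \<in> X" if "x \<in> D" for x using that by (simp add: D_def)
  have DY: "y \<in> Y" if "y \<in> D'" for y using that by (simp add: D'_def)
  define f where "f x = (if x \<in> D then h x else J (h (I x)))" for x
  have f_Y: "f x \<in> Y" and f_lab: "lab' (f x) = lab x" and f_comm: "f (I x) = J (f x)"
    and f_D: "f x \<in> D' \<longleftrightarrow> x \<in> D" if x: "x \<in> X" for x
  proof -
    show "f x \<in> Y" using x h[of x] h[of "I x"] D_I[OF x] DY J by (auto simp: f_def)
    show "lab' (f x) = lab x" using x h[of x] h[of "I x"] D_I[OF x] I[OF x] by (auto simp: f_def)
    show "f (I x) = J (f x)"
      using h[of "I x"] D_I[OF x] I[OF x] J DY by (auto simp: f_def)
    show "f x \<in> D' \<longleftrightarrow> x \<in> D"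
      using h[of x] h[of "I x"] D_I[OF x] D_J DY by (auto simp: f_def)
  qed
  have "inj_on f X"
  proof (rule inj_onI)
    fix x y assume xy: "x \<in> X" "y \<in> X" "f x = f y"
    show "x = y"
    proof (cases "x \<in> D")
      case True
      then have "y \<in> D" using f_D[OF xy(1)] f_D[OF xy(2)] xy(3) by simp
      then show ?thesis using True xy(3) by (auto simp: f_def intro: h_inj)
    next
      case False
      then have "y \<notin> D" using f_D[OF xy(1)] f_D[OF xy(2)] xy(3) by simp
      then have D: "I x \<in> D" "I y \<in> D" using False D_I xy by auto
      have "f (I x) = f (I y)" using xy f_comm by simp
      then have "I x = I y" using D by (auto simp: f_def intro: h_inj)
      then show ?thesis using I xy by metis
    qed
  qed
  moreover have "f ` X = Y"
  proof (intro subset_antisym subsetI)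
    fix y assume y: "y \<in> Y"
    show "y \<in> f ` X"
    proof (cases "y \<in> D'")
      case True
      then obtain x where "x \<in> D" "h x = y" using h_surj by blast
      then show ?thesis using DX by (auto simp: f_def image_iff)
    next
      case False
      then have "J y \<in> D'" using D_J y by blast
      then obtain x where x: "x \<in> D" "h x = J y" using h_surj by blast
      then have "f (I x) = y" using f_comm[OF DX[OF x(1)]] J[OF y] by (simp add: f_def)
      then show ?thesis using I[OF DX[OF x(1)]] by blast
    qed
  qed (use f_Y in auto)
  ultimately have "bij_betw f X Y" by (simp add: bij_betw_def)
  then show ?thesis using f_lab f_comm by (rule that)
qed

lemma I_map_flips_side: "x \<in> occs ws \<Longrightarrow> fst (snd (I_map ws x)) = (\<not> fst (snd x))"
  by (cases x) (simp add: I_map_def Psi.simps)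

lemma UNIV_letter: "(UNIV :: letter set) = {GenA, InvA, GenB, InvB}"
proof (intro set_eqI iffI UNIV_I)
  fix x :: letter show "x \<in> {GenA, InvA, GenB, InvB}" by (cases x) simp_all
qed

lemma image_I_map_occs_of: "I_map ws ` occs_of ws c = {x \<in> occs ws. letter_at ws (I_map ws x) = c}"
proof (intro subset_antisym subsetI)
  fix x assume "x \<in> {x \<in> occs ws. letter_at ws (I_map ws x) = c}"
  then have "x = I_map ws (I_map ws x)" "I_map ws x \<in> occs_of ws c"
    by (auto simp: I_map_invol I_map_in_occs occs_of_def)
  then show "x \<in> I_map ws ` occs_of ws c" by (rule image_eqI)
next
  fix x assume "x \<in> I_map ws ` occs_of ws c"
  then obtain y where "y \<in> occs_of ws c" "x = I_map ws y" by blast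
  then show "x \<in> {x \<in> occs ws. letter_at ws (I_map ws x) = c}"
    by (simp add: I_map_invol I_map_in_occs occs_of_def)
qed

lemma card_occs_of_cells:
  "card (occs_of ws c) = (\<Sum>d\<in>UNIV. card (I_map ws ` occs_of ws d \<inter> occs_of ws c))"
proof -
  have "occs_of ws c = (\<Union>d\<in>UNIV. I_map ws ` occs_of ws d \<inter> occs_of ws c)"
    unfolding image_I_map_occs_of by (auto simp: occs_of_def)
  also have "card \<dots> = (\<Sum>d\<in>UNIV. card (I_map ws ` occs_of ws d \<inter> occs_of ws c))"
    by (rule card_UN_disjoint) (auto simp: UNIV_letter image_I_map_occs_of)
  finally show ?thesis .
qed

text \<open>
  The cardinalities for distinct letters determine those for equal letters, because the sets
  \<open>I(A) \<inter> B\<close> partition \<open>B\<close>. The latter do not vanish in general: a reduced word need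
  not be cyclically reduced.
\<close>

lemma ex_equivariant_relabelling:
  assumes card: "\<And>c. card (occs_of ws c) = card (occs_of ws' c)"
    and cells: "\<And>c d. c \<noteq> d \<Longrightarrow> card (I_map ws ` occs_of ws c \<inter> occs_of ws d) =
      card (I_map ws' ` occs_of ws' c \<inter> occs_of ws' d)"
  obtains f where "bij_betw f (occs ws) (occs ws')" "\<And>c. bij_betw f (occs_of ws c) (occs_of ws' c)"
    "\<And>x. x \<in> occs ws \<Longrightarrow> f (I_map ws x) = I_map ws' (f x)"
proof -
  define rank :: "letter \<Rightarrow> nat" where "rank c = (case c of GenA \<Rightarrow> 0 | InvA \<Rightarrow> 1 | GenB \<Rightarrow> 2 | InvB \<Rightarrow> 3)" for c
  have rank_inj: "rank c = rank d \<longleftrightarrow> c = d" for c d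
    by (cases c; cases d) (simp_all add: rank_def)
  have all_cells: "card (I_map ws ` occs_of ws c \<inter> occs_of ws d) =
      card (I_map ws' ` occs_of ws' c \<inter> occs_of ws' d)" for c d
  proof (cases "c = d")
    case True
    have fin: "finite (UNIV :: letter set)" by (simp add: UNIV_letter)
    have "(\<Sum>e\<in>UNIV - {c}. card (I_map ws ` occs_of ws e \<inter> occs_of ws c)) =
        (\<Sum>e\<in>UNIV - {c}. card (I_map ws' ` occs_of ws' e \<inter> occs_of ws' c))"
      by (intro sum.cong) (auto simp: cells)
    then show ?thesis
      using card[of c] True unfolding card_occs_of_cells by (simp add: sum.remove[OF fin, of c])
  qed (rule cells)
  have cell: "{x \<in> occs vs. rank (letter_at vs x) = rank c \<and> rank (letter_at vs (I_map vs x)) = rank d} =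
      I_map vs ` occs_of vs d \<inter> occs_of vs c" for vs c d
    unfolding image_I_map_occs_of rank_inj by (auto simp: occs_of_def)
  have cell_card: "card {x \<in> occs ws. rank (letter_at ws x) = r \<and> rank (letter_at ws (I_map ws x)) = t} =
      card {x \<in> occs ws'. rank (letter_at ws' x) = r \<and> rank (letter_at ws' (I_map ws' x)) = t}" for r t
  proof (cases "\<exists>c d. r = rank c \<and> t = rank d")
    case True
    then show ?thesis using all_cells cell by auto
  next
    case False
    then have empty: "{x \<in> occs vs. rank (letter_at vs x) = r \<and> rank (letter_at vs (I_map vs x)) = t} = {}" for vs
      by auto
    show ?thesis by (simp only: empty)
  qed
  obtain f where f: "bij_betw f (occs ws) (occs ws')"
    "\<And>x. x \<in> occs ws \<Longrightarrow> rank (letter_at ws' (f x)) = rank (letter_at ws x)"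
    "\<And>x. x \<in> occs ws \<Longrightarrow> f (I_map ws x) = I_map ws' (f x)"
    by (rule labelled_involutions_isomorphic[where X = "occs ws" and Y = "occs ws'"
          and I = "I_map ws" and J = "I_map ws'"
          and side = "\<lambda>x. fst (snd x)" and side' = "\<lambda>x. fst (snd x)"
          and lab = "\<lambda>x. rank (letter_at ws x)" and lab' = "\<lambda>x. rank (letter_at ws' x)",
          OF finite_occs finite_occs _ _ cell_card])
      (simp_all add: I_map_in_occs I_map_invol I_map_flips_side)
  have "bij_betw f (occs_of ws c) (occs_of ws' c)" for c
  proof (rule bij_betw_subset[OF f(1)])
    show "occs_of ws c \<subseteq> occs ws" by (auto simp: occs_of_def)
    show "f ` occs_of ws c = occs_of ws' c"
    proof (intro subset_antisym subsetI)
      fix y assume y: "y \<in> occs_of ws' c"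
      then have "y \<in> f ` occs ws" using f(1) by (simp add: bij_betw_def occs_of_def)
      then obtain x where "x \<in> occs ws" "y = f x" by blast
      then show "y \<in> f ` occs_of ws c" using y f(2)[of x] by (auto simp: occs_of_def rank_inj)
    next
      fix y assume "y \<in> f ` occs_of ws c"
      then obtain x where "x \<in> occs_of ws c" "y = f x" by blast
      then show "y \<in> occs_of ws' c"
        using f(2)[of x] bij_betwE[OF f(1)] by (auto simp: occs_of_def rank_inj)
    qed
  qed
  then show ?thesis using that f(1,3) by blast
qed

lemma R_element_relabel:
  assumes f: "bij_betw f (occs ws) (occs ws')" "\<And>c. bij_betw f (occs_of ws c) (occs_of ws' c)"
    and comm: "\<And>x. x \<in> occs ws \<Longrightarrow> f (I_map ws x) = I_map ws' (f x)"
    and q: "q \<in> perms4 ws"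
  shows "R_element N ws' (relabel4 ws (\<lambda>_. f) q) = R_element N ws q"
proof -
  obtain \<sigma>u \<theta>u \<sigma>v \<theta>v where q_eq: "q = (\<sigma>u, \<theta>u, \<sigma>v, \<theta>v)" by (cases q) auto
  let ?q' = "relabel4 ws (\<lambda>_. f) q"
  have perm: "\<sigma>u permutes occs_of ws GenA" "\<theta>u permutes occs_of ws InvA"
    "\<sigma>v permutes occs_of ws GenB" "\<theta>v permutes occs_of ws InvB"
    using q by (simp_all add: q_eq perms4_def)
  then have q': "?q' \<in> perms4 ws'"
    using map_permutation_permutes[OF f(2)] by (simp add: q_eq perms4_def)
  have inj: "inj_on f (occs_of ws c)" for c using f(2) by (rule bij_betw_imp_inj_on)
  have glue: "f (glue ws q x) = glue ws' ?q' (f x)" if x: "x \<in> occs ws" for x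
  proof -
    have "x \<in> occs_of ws (letter_at ws x)" using x by (simp add: occs_of_def)
    moreover from this have "f x \<in> occs_of ws' (letter_at ws x)" using f(2) by (meson bij_betwE)
    ultimately show ?thesis
      using x by (cases "letter_at ws x")
        (simp_all add: q_eq occs_of_def[of ws'] map_permutation_apply[OF inj])
  qed
  have "num_cycles (occs ws') (I_map ws' \<circ> glue ws' ?q') = num_cycles (occs ws) (I_map ws \<circ> glue ws q)"
  proof (rule num_cycles_conjugate[OF f(1)])
    show "(I_map ws \<circ> glue ws q) permutes occs ws"
      using glue_permutes[OF q] I_map_permutes by (rule permutes_compose)
    fix x assume x: "x \<in> occs ws"
    then have "glue ws q x \<in> occs ws" using permutes_in_image[OF glue_permutes[OF q]] by simp
    then show "f ((I_map ws \<circ> glue ws q) x) = (I_map ws' \<circ> glue ws' ?q') (f x)"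
      using comm glue[OF x] by simp
  qed
  then show ?thesis using q q' by (simp add: R_element_def)
qed

theorem proposition5p1:
  fixes \<mu> :: "(complex ^ 'N ^ 'N) measure"
    and ws :: "letter list list"
    and n m :: nat
  assumes haar: "haar_measure \<mu>"
    and words: "\<forall>w \<in> set ws. w \<noteq> [] \<and> reduced w"
    and n: "card (occs_of ws GenA) = n"
    and m: "card (occs_of ws GenB) = m"
    and N: "CARD('N) > max n m"
  shows "(\<forall>ws'. (\<forall>w \<in> set ws'. w \<noteq> [] \<and> reduced w) \<longrightarrow>
            card (occs_of ws' GenA) = n \<longrightarrow> card (occs_of ws' GenB) = m \<longrightarrow>
            (\<forall>c d. c \<noteq> d \<longrightarrow>
               card (I_map ws ` occs_of ws c \<inter> occs_of ws d) =
               card (I_map ws' ` occs_of ws' c \<inter> occs_of ws' d)) \<longrightarrow>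
            (\<exists>f. (\<forall>c. bij_betw (f c) (occs_of ws c) (occs_of ws' c)) \<and>
               (\<forall>q \<in> perms4 ws.
                  R_element CARD('N) ws' (relabel4 ws f q) = R_element CARD('N) ws q)))
         \<and> complex_of_real
              (\<integral>U. (\<integral>V. (\<Prod>w\<leftarrow>ws. (cmod (trace (word_matrix U V w)))\<^sup>2) \<partial>\<mu>) \<partial>\<mu>)
            = Phi CARD('N) ws (R_element CARD('N) ws)"
proof (intro conjI allI impI)
  fix ws'
  assume n': "card (occs_of ws' GenA) = n" and m': "card (occs_of ws' GenB) = m"
    and cells: "\<forall>c d. c \<noteq> d \<longrightarrow> card (I_map ws ` occs_of ws c \<inter> occs_of ws d) =
      card (I_map ws' ` occs_of ws' c \<inter> occs_of ws' d)"
  have card: "card (occs_of ws c) = card (occs_of ws' c)" for c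
    using n m n' m' card_occs_of_inv[of _ GenA] card_occs_of_inv[of _ GenB] by (cases c) simp_all
  show "\<exists>f. (\<forall>c. bij_betw (f c) (occs_of ws c) (occs_of ws' c)) \<and>
      (\<forall>q \<in> perms4 ws. R_element CARD('N) ws' (relabel4 ws f q) = R_element CARD('N) ws q)"
  proof (rule ex_equivariant_relabelling[OF card cells[rule_format]])
    fix f
    assume f: "bij_betw f (occs ws) (occs ws')" "\<And>c. bij_betw f (occs_of ws c) (occs_of ws' c)"
      "\<And>x. x \<in> occs ws \<Longrightarrow> f (I_map ws x) = I_map ws' (f x)"
    show ?thesis
      by (intro exI[where x = "\<lambda>_. f"] conjI allI ballI f(2) R_element_relabel[where f = f, OF f])
  qed
next
  show "complex_of_real
      (\<integral>U. (\<integral>V. (\<Prod>w\<leftarrow>ws. (cmod (trace (word_matrix U V w)))\<^sup>2) \<partial>\<mu>) \<partial>\<mu>)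
    = Phi CARD('N) ws (R_element CARD('N) ws)"
    using words n m N by (intro integral_eq_Phi_R[OF haar]) auto
qed

end
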